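(* Let $p$ be a prime, $s\ge 1$, $q=p^s$, and let $m,\ell$ be positive integers. Set $e=\frac{q^m-1}{q-1}$ and let $\gamma$ be a primitive element of $\mathbb{F}_{q^m}$. Let $\alpha$ and $\beta$ be primitive elements of $\mathbb{F}_{q^{m\ell}}$ and $\mathbb{F}_{q^{m(\ell+1)}}$ respectively with $N_{q^{m\ell}/q^m}(\alpha)=\gamma$ and $N_{q^{m(\ell+1)}/q^m}(\beta)=\gamma$, and for $0\le i\le e-1$ (indices taken mod $e$) let $C_i^{(e,q^{m\ell})}=\alpha^i\langle\alpha^e\rangle$, $C_i^{(e,q^{m(\ell+1)})}=\beta^i\langle\beta^e\rangle$ and $C_i^{(e,q^m)}=\gamma^i\langle\gamma^e\rangle$. For $0\le r\le m$, let $R$ be an $r$-dimensional $\mathbb{F}_q$-subspace of $\mathbb{F}_{q^m}$, let $R^*=R\setminus\{0\}$, and define $$T=\{0\le i<e : \gamma^i\in R\}.$$ Then $$D_{r,T}=\bigcup_{i=0}^{e-1}\Big(C_i^{(e,q^{m\ell})}\times \bigcup_{t\in T} C_{i+t}^{(e,q^{m(\ell+1)})}\Big)\ \cup\ \big(\mathbb{F}_{q^{m\ell}}^*\times\{0\}\big)$$ is a $(v,k_r,\lambda_r,\mu_r)$ partial difference set in the elementary abelian $p$-group $G=(\mathbb{F}_{q^{m\ell}}\times\mathbb{F}_{q^{m(\ell+1)}},+)\cong\mathbb{Z}_p^{sm(2\ell+1)}$, where \begin{align*} v &= q^{m(2\ell+1)},\\ k_r &= \frac{(q^r-1)(q^{m\ell}-1)(q^{m(\ell+1)}-1)}{q^m-1}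 + q^{m\ell}-1,\\ \lambda_r &= \frac{(q^r-1)(q^{m(\ell+1)}-1)}{q^m-1}\Big(\frac{(q^r-1)(q^{m\ell}-1)}{q^m-1}-1\Big) + q^{m\ell}-2,\\ \mu_r &= \frac{(q^r-1)(q^{m\ell}-1)}{q^m-1}\Big(\frac{(q^r-1)(q^{m(\ell+1)}-1)}{q^m-1}+1\Big). \end{align*} Moreover, \begin{align*} D_{r,T}&=\Big\{(a,b): ab\ne 0,\ \tfrac{N_{q^{m(\ell+1)}/q^m}(b)}{N_{q^{m\ell}/q^m}(a)}\in \textstyle\bigcup_{t\in T}C_t^{(e,q^m)}\Big\}\cup\{(a,0): a\in\mathbb{F}_{q^{m\ell}}^*\}\\ &=\Big\{(a,b): ab\ne 0,\ \tfrac{N_{q^{m(\ell+1)}/q^m}(b)}{N_{q^{m\ell}/q^m}(a)}\in R^*\Big\}\cup\{(a,0): a\in\mathbb{F}_{q^{m\ell}}^*\}. \end{align*} Consequently, $\mathrm{Cay}(G,D_{r,T})$ is a $(v,k_r,\lambda_r,\mu_r)$ strongly regular graph, and $\mathbb{F}_{q^{m\ell}}\times\{0\}$ is a maximum clique in it, of size $q^{m\ell}$.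
   Context: For a prime power $Q$ and $m\mid n$, $N_{Q^n/Q^m}(x)=x^{(Q^n-1)/(Q^m-1)}$ is the norm map from $\mathbb{F}_{Q^n}$ to $\mathbb{F}_{Q^m}$. For a primitive element $\omega$ of $\mathbb{F}_Q$ and $e\mid Q-1$, $\langle\omega^e\rangle$ is the subgroup of $\mathbb{F}_Q^*$ generated by $\omega^e$. A subset $D\subseteq G$ of a finite abelian group $G$ of order $v$ with $|D|=k$ and $0_G\notin D$ is a $(v,k,\lambda,\mu)$ partial difference set if the differences $g-h$, $g,h\in D$, $g\ne h$, represent each element of $D$ exactly $\lambda$ times and each nonidentity element of $G\setminus D$ exactly $\mu$ times. $\mathrm{Cay}(G,D)$ is the graph on $G$ with $g\sim h$ iff $g-h\in D$; a $(v,k,\lambda,\mu)$ strongly regular graph is a $k$-regular graph on $v$ vertices where adjacent pairs have $\lambda$ and distinct non-adjacent pairs $\mu$ common neighbours. A clique is a set of pairwise adjacent vertices. *)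

theory Defs
  imports
    Complex_Main
    "HOL-Algebra.Algebraic_Closure_Type"
    "HOL-Algebra.Elementary_Groups"
    "HOL-Algebra.Product_Groups"
    "Graph_Theory.Pair_Digraph"
begin

text \<open>
  All finite fields involved are subfields of one ambient field, given by a type of class
  \<^class>\<open>field\<close>; a subfield is a subset \<open>F\<close> with
  \<^term>\<open>subfield F ring_of_type_algebra\<close>, and the field of order \<open>Q\<close> is such a subset of
  cardinality \<open>Q\<close>. A subfield of order \<open>q ^ m\<close> is then automatically contained in a subfield
  of order \<open>q ^ (m * l)\<close>, so that norms and their quotients are formed in the ambient field.
\<close>

definition additive_group :: "'f::field set \<Rightarrow> 'f monoid" where
  "additive_group F =
     \<lparr>carrier = F, monoid.mult = (+), one = 0\<rparr>"

definition cyclic_subgroup :: "'f::field \<Rightarrow> 'f set" where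
  "cyclic_subgroup x = range (\<lambda>j::int. x powi j)"

definition primitive_element :: "'f::field set \<Rightarrow> 'f \<Rightarrow> bool" where
  "primitive_element F w \<longleftrightarrow> w \<in> F \<and> cyclic_subgroup w = F - {0}"

definition cyclotomic_class :: "nat \<Rightarrow> 'f::field \<Rightarrow> nat \<Rightarrow> 'f set" where
  "cyclotomic_class e w i = (\<lambda>y. w ^ i * y) ` cyclic_subgroup (w ^ e)"

text \<open>
  \<open>field_norm Q n m\<close> is the norm from the field of order \<open>Q ^ n\<close> to the one of order \<open>Q ^ m\<close>,
  where \<open>m\<close> divides \<open>n\<close>, so that the division is exact.
\<close>

definition field_norm :: "nat \<Rightarrow> nat \<Rightarrow> nat \<Rightarrow> 'f::field \<Rightarrow> 'f" where
  "field_norm Q n m x = x ^ ((Q ^ n - 1) div (Q ^ m - 1))"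

definition partial_difference_set ::
    "('a, 'b) monoid_scheme \<Rightarrow> 'a set \<Rightarrow> nat \<Rightarrow> nat \<Rightarrow> nat \<Rightarrow> nat \<Rightarrow> bool" where
  "partial_difference_set G D v k lam mu \<longleftrightarrow>
     comm_group G \<and> finite (carrier G) \<and> card (carrier G) = v \<and>
     D \<subseteq> carrier G \<and> card D = k \<and> \<one>\<^bsub>G\<^esub> \<notin> D \<and>
     (\<forall>x\<in>D. card {(g, h). g \<in> D \<and> h \<in> D \<and> g \<noteq> h \<and> g \<otimes>\<^bsub>G\<^esub> inv\<^bsub>G\<^esub> h = x} = lam) \<and>
     (\<forall>x\<in>carrier G - D - {\<one>\<^bsub>G\<^esub>}.
        card {(g, h). g \<in> D \<and> h \<in> D \<and> g \<noteq> h \<and> g \<otimes>\<^bsub>G\<^esub> inv\<^bsub>G\<^esub> h = x} = mu)"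

definition Cay :: "('a, 'b) monoid_scheme \<Rightarrow> 'a set \<Rightarrow> 'a pair_pre_digraph" where
  "Cay G D =
     \<lparr>pverts = carrier G,
      parcs = {(g, h). g \<in> carrier G \<and> h \<in> carrier G \<and> g \<otimes>\<^bsub>G\<^esub> inv\<^bsub>G\<^esub> h \<in> D}\<rparr>"

text \<open>
  The locale \<^locale>\<open>pair_graph\<close> describes finite simple graphs: the arc relation is
  symmetric and has no loops.
\<close>

definition strongly_regular_graph ::
    "'a pair_pre_digraph \<Rightarrow> nat \<Rightarrow> nat \<Rightarrow> nat \<Rightarrow> nat \<Rightarrow> bool" where
  "strongly_regular_graph H v k lam mu \<longleftrightarrow>
     pair_graph H \<and> card (pverts H) = v \<and>
     (\<forall>x\<in>pverts H. card {z \<in> pverts H. (x, z) \<in> parcs H} = k) \<and>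
     (\<forall>x\<in>pverts H. \<forall>y\<in>pverts H. (x, y) \<in> parcs H \<longrightarrow>
        card {z \<in> pverts H. (x, z) \<in> parcs H \<and> (y, z) \<in> parcs H} = lam) \<and>
     (\<forall>x\<in>pverts H. \<forall>y\<in>pverts H. x \<noteq> y \<and> (x, y) \<notin> parcs H \<longrightarrow>
        card {z \<in> pverts H. (x, z) \<in> parcs H \<and> (y, z) \<in> parcs H} = mu)"

definition clique :: "'a pair_pre_digraph \<Rightarrow> 'a set \<Rightarrow> bool" where
  "clique H S \<longleftrightarrow> S \<subseteq> pverts H \<and> (\<forall>x\<in>S. \<forall>y\<in>S. x \<noteq> y \<longrightarrow> (x, y) \<in> parcs H)"

definition maximum_clique :: "'a pair_pre_digraph \<Rightarrow> 'a set \<Rightarrow> bool" where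
  "maximum_clique H S \<longleftrightarrow> clique H S \<and> (\<forall>S'. clique H S' \<longrightarrow> card S' \<le> card S)"

end

theory Submission
  imports Defs
begin

text \<open>
  Write \<open>Q = q ^ m\<close> and let \<open>N\<close> denote the norms to \<open>K\<close>. The set \<open>D\<close> consists of the \<open>(a, b)\<close> with
  \<open>a \<noteq> 0\<close> and \<open>N b / N a \<in> R\<close>, and it is a partial difference set because its sum over a nontrivial
  additive character of \<open>A \<times> B\<close> takes only two values \<open>\<theta>\<^sub>1, \<theta>\<^sub>2\<close>: Fourier inversion then gives
  \<open>D * D = (\<theta>\<^sub>1 + \<theta>\<^sub>2) D - \<theta>\<^sub>1 \<theta>\<^sub>2 \<delta>\<^sub>0 + const\<close>.

  The essential character sum is that of \<open>\<psi> (Tr a + Tr b)\<close> over \<open>N b = y N a\<close>. By the Davenport--Hasse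
  relation the sum over \<open>b\<close> in the field of order \<open>Q ^ (l + 1)\<close> is minus the multiplicative convolution
  of the corresponding sum over the field of order \<open>Q ^ l\<close> with \<open>\<psi>\<close> on \<open>K\<close>; what is left are two factors
  over the same field, which collapse by orthogonality and leave \<open>- Q ^ l \<psi> (\<plusminus> y)\<close> plus a constant.
  Summing over \<open>y \<in> R\<close> sees only whether \<open>\<psi>\<close> is trivial on a multiple of \<open>R\<close>.

  The Davenport--Hasse relation follows from Newton's identity for the \<open>L\<close>-function of monic polynomials
  over \<open>K\<close>, weighted by \<open>\<psi>\<close> of the sum of the roots and with prescribed product of the roots: the sum
  over all polynomials of a given degree vanishes from degree \<open>2\<close> on.
\<close>

section \<open>Davenport--Hasse by Newton's identity\<close>

text \<open>Monic polynomials over the fixed field of a Frobenius map are represented by their multisets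
  of roots, which are the multisets stable under that map.\<close>

definition orbit_mset :: "('a \<Rightarrow> 'a) \<Rightarrow> nat \<Rightarrow> 'a \<Rightarrow> 'a multiset" where
  "orbit_mset F j a = image_mset (\<lambda>i. (F ^^ i) a) (mset_set {..<j})"

definition stable_msets :: "('a \<Rightarrow> 'a) \<Rightarrow> nat \<Rightarrow> 'a multiset set" where
  "stable_msets F n = {M. image_mset F M = M \<and> size M = n}"

definition root_poly :: "'a::field multiset \<Rightarrow> 'a poly" where
  "root_poly M = (\<Prod>x\<in>#M. [:-x, 1:])"

lemma size_orbit_mset [simp]: "size (orbit_mset F j a) = j"
  by (simp add: orbit_mset_def)

lemma orbit_mset_0 [simp]: "orbit_mset F 0 a = {#}"
  by (simp add: orbit_mset_def)

lemma orbit_mset_Suc: "orbit_mset F (Suc j) a = add_mset ((F ^^ j) a) (orbit_mset F j a)"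
  by (simp add: orbit_mset_def lessThan_Suc)

lemma orbit_mset_Suc_left: "orbit_mset F (Suc j) a = add_mset a (orbit_mset F j (F a))"
proof (induction j)
  case 0
  then show ?case by (simp add: orbit_mset_Suc)
next
  case (Suc j)
  have "orbit_mset F (Suc (Suc j)) a = add_mset ((F ^^ Suc j) a) (add_mset a (orbit_mset F j (F a)))"
    by (subst orbit_mset_Suc) (simp only: Suc)
  then show ?case
    by (simp add: orbit_mset_Suc funpow_swap1)
qed

lemma orbit_mset_add: "orbit_mset F (i + j) a = orbit_mset F i a + orbit_mset F j ((F ^^ i) a)"
proof (induction j)
  case (Suc j)
  have "(F ^^ (i + j)) a = (F ^^ j) ((F ^^ i) a)"
    by (metis add.commute comp_apply funpow_add)
  with Suc show ?case by (simp add: orbit_mset_Suc)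
qed simp

lemma image_orbit_mset: "image_mset F (orbit_mset F j a) = orbit_mset F j (F a)"
  by (induction j) (auto simp: orbit_mset_Suc funpow_swap1)

lemma orbit_mset_stable:
  assumes "(F ^^ j) a = a"
  shows "image_mset F (orbit_mset F j a) = orbit_mset F j a"
  using orbit_mset_Suc[of F j a] orbit_mset_Suc_left[of F j a] assms
  by (simp add: image_orbit_mset)

lemma orbit_mset_mult:
  assumes "(F ^^ d) a = a"
  shows "orbit_mset F (d * k) a = repeat_mset k (orbit_mset F d a)"
proof (induction k)
  case (Suc k)
  have "orbit_mset F (d * Suc k) a = orbit_mset F d a + orbit_mset F (d * k) ((F ^^ d) a)"
    by (simp add: orbit_mset_add)
  then show ?case by (simp add: assms Suc)
qed simp

lemma degree_root_poly [simp]: "Polynomial.degree (root_poly M) = size M"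
  and lead_coeff_root_poly [simp]: "Polynomial.coeff (root_poly M) (size M) = 1"
  and root_poly_nonzero [simp]: "root_poly M \<noteq> 0"
proof -
  have nz: "root_poly M \<noteq> 0" for M :: "'a multiset"
    by (auto simp: root_poly_def prod_mset_zero_iff)
  have d: "Polynomial.degree (root_poly M) = size M \<and> Polynomial.lead_coeff (root_poly M) = 1"
  proof (induction M)
    case (add x M)
    have "root_poly (add_mset x M) = [:-x,1:] * root_poly M" by (simp add: root_poly_def)
    with add nz[of M] show ?case
      using lead_coeff_mult[of "[:-x,1:]" "root_poly M"]
      by (auto simp add: degree_mult_eq simp del: mult_pCons_left)
  qed (simp add: root_poly_def)
  then show "Polynomial.degree (root_poly M) = size M" "Polynomial.coeff (root_poly M) (size M) = 1"
    by auto
  show "root_poly M \<noteq> 0" by (rule nz)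
qed

lemma proots_root_poly [simp]: "proots (root_poly M) = M"
proof (induction M)
  case (add x M)
  have "root_poly (add_mset x M) = [:-x,1:] * root_poly M" by (simp add: root_poly_def)
  then show ?case using add by (simp add: proots_mult del: mult_pCons_left)
qed (simp add: root_poly_def)

lemma root_poly_proots:
  fixes f :: "'a::alg_closed_field poly"
  assumes "Polynomial.lead_coeff f = 1"
  shows "root_poly (proots f) = f"
proof -
  have "f \<noteq> 0" using assms by auto
  then obtain A where A: "f = root_poly A"
    using alg_closed_imp_factorization[of f] assms by (auto simp: root_poly_def)
  then show ?thesis by simp
qed

lemma coeff_0_root_poly: "Polynomial.coeff (root_poly M) 0 = (- 1) ^ size M * prod_mset M"
  by (induction M) (auto simp: root_poly_def)

lemma subleading_coeff_root_poly:
  assumes "M \<noteq> {#}"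
  shows "Polynomial.coeff (root_poly M) (size M - 1) = - sum_mset M"
  using assms
proof (induction M)
  case (add x M)
  have eq: "root_poly (add_mset x M) = [:-x,1:] * root_poly M" by (simp add: root_poly_def)
  show ?case
  proof (cases "M = {#}")
    case True
    then show ?thesis by (simp add: root_poly_def)
  next
    case False
    then obtain n where n: "size M = Suc n"
      by (metis Suc_pred nonempty_has_size)
    have "Polynomial.coeff (root_poly (add_mset x M)) (Suc n) = - x * Polynomial.coeff (root_poly M) (Suc n) + Polynomial.coeff (root_poly M) n"
      unfolding eq by simp
    then show ?thesis
      using add False n lead_coeff_root_poly[of M] by simp
  qed
qed simp

text \<open>The intended instance is \<open>x ^ Q\<close> on an algebraic closure: there every monic
  polynomial over the fixed field is visible as its multiset of roots, while the elements fixed by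
  \<open>F ^^ j\<close> form the extension of degree j.\<close>

locale frobenius_map =
  fixes F :: "'a::alg_closed_field \<Rightarrow> 'a"
  assumes F_add: "F (x + y) = F x + F y"
    and F_mult: "F (x * y) = F x * F y"
    and F_1: "F 1 = 1"
    and finite_fixed: "j \<ge> 1 \<Longrightarrow> finite {x. (F ^^ j) x = x}"
begin

lemma F_0: "F 0 = 0"
  using F_add[of 0 0] by (metis add_cancel_right_right add_0)

lemma F_minus: "F (- x) = - F x"
  using F_add[of x "- x"] by (metis F_0 add.right_inverse add_eq_0_iff)

lemma F_diff: "F (x - y) = F x - F y"
  using F_add[of x "- y"] by (simp add: F_minus)

lemma inj_F: "inj F"
proof
  fix x y assume "F x = F y"
  then have "F (x - y) = 0" by (simp add: F_diff)
  then have "x - y = 0"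
    using F_mult[of "x - y" "inverse (x - y)"] by (cases "x - y = 0") (auto simp: F_1)
  then show "x = y" by simp
qed

lemma map_poly_F_root_poly: "map_poly F (root_poly M) = root_poly (image_mset F M)"
proof (induction M)
  case (add x M)
  have eq: "root_poly (add_mset x M) = pCons 0 (root_poly M) - smult x (root_poly M)" for x and M :: "'a multiset"
    by (simp add: root_poly_def)
  have "map_poly F (pCons 0 p - smult x p) = pCons 0 (map_poly F p) - smult (F x) (map_poly F p)" for p
    by (rule poly_eqI) (auto simp: coeff_map_poly F_0 F_diff F_mult F_minus coeff_pCons split: nat.splits)
  then show ?case
    using add by (simp add: eq)
qed (simp add: root_poly_def F_1)

text \<open>A monic polynomial and its root multiset determine each other, so permuting the roots by
  \<open>F\<close> and fixing the coefficients under \<open>F\<close> are the same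
  condition.\<close>

lemma stable_iff_root_poly: "image_mset F M = M \<longleftrightarrow> (\<forall>i. F (Polynomial.coeff (root_poly M) i) = Polynomial.coeff (root_poly M) i)"
proof -
  have "image_mset F M = M \<longleftrightarrow> map_poly F (root_poly M) = root_poly M"
    unfolding map_poly_F_root_poly using proots_root_poly by metis
  then show ?thesis by (auto simp: poly_eq_iff coeff_map_poly F_0)
qed

text \<open>Subtracting \<open>z X^(d-1)\<close> from the polynomial moves the sum of the roots and keeps their product.\<close>

lemma stable_msets_shift:
  assumes "d \<ge> 2" and z: "F z = z" and M: "M \<in> stable_msets F d"
  defines "\<tau> \<equiv> \<lambda>z M. proots (root_poly M - Polynomial.monom z (d - 1))"
  shows "\<tau> z M \<in> stable_msets F d" "sum_mset (\<tau> z M) = sum_mset M + z"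
    "prod_mset (\<tau> z M) = prod_mset M" "\<tau> (- z) (\<tau> z M) = M"
proof -
  let ?f = "root_poly M - Polynomial.monom z (d - 1)"
  have M': "size M = d" "image_mset F M = M" using M by (auto simp: stable_msets_def)
  have df: "Polynomial.degree ?f = d" 
  proof (rule antisym)
    show "Polynomial.degree ?f \<le> d"
      by (rule degree_diff_le) (use M' degree_monom_le[of z "d - 1"] in auto)
    show "d \<le> Polynomial.degree ?f"
      by (rule le_degree) (use assms M' lead_coeff_root_poly[of M] in auto)
  qed
  have "Polynomial.lead_coeff ?f = 1"
    unfolding df using assms M' lead_coeff_root_poly[of M] by simp
  from root_poly_proots[OF this] have rp: "root_poly (\<tau> z M) = ?f" by (simp add: \<tau>_def)
  have sz: "size (\<tau> z M) = d" using df rp by (metis degree_root_poly)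
  have "image_mset F (\<tau> z M) = \<tau> z M"
    unfolding stable_iff_root_poly rp using M'(2) z
    by (auto simp: stable_iff_root_poly F_diff F_0)
  with sz show st: "\<tau> z M \<in> stable_msets F d" by (simp add: stable_msets_def)
  have "M \<noteq> {#}" "\<tau> z M \<noteq> {#}" using M' sz assms by auto
  then show "sum_mset (\<tau> z M) = sum_mset M + z"
    using subleading_coeff_root_poly[of M] subleading_coeff_root_poly[of "\<tau> z M"] sz M' 
    by (simp add: rp algebra_simps)
  show "prod_mset (\<tau> z M) = prod_mset M"
    using coeff_0_root_poly[of M] coeff_0_root_poly[of "\<tau> z M", unfolded rp] assms(1) M' sz
    by simp
  have "\<tau> (- z) (\<tau> z M) = proots (root_poly (\<tau> z M) - Polynomial.monom (- z) (d - 1))"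
    by (simp add: \<tau>_def)
  also have "\<dots> = M" unfolding rp by (simp flip: minus_monom)
  finally show "\<tau> (- z) (\<tau> z M) = M" .
qed

lemma stable_count:
  assumes "image_mset F M = M"
  shows "count M ((F ^^ i) a) = count M a"
proof (induction i)
  case (Suc i)
  have "count (image_mset F M) (F x) = count M x" for x
    using inj_F by (induction M) (auto dest: injD)
  then show ?case using Suc assms by simp
qed simp

lemma funpow_inj: "(F ^^ i) x = (F ^^ i) y \<longleftrightarrow> x = y"
  using inj_F by (metis inj_fn injD)

text \<open>If \<open>d\<close> is the period of \<open>a\<close>, then the orbit multisets of \<open>a\<close> contained in \<open>M\<close> are those of length
  \<open>d k\<close> with \<open>k\<close> at most the multiplicity of \<open>a\<close>.\<close>

lemma card_orbits_at:
  assumes st: "image_mset F M = M" and a: "a \<in># M"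
  shows "card {j. 1 \<le> j \<and> (F ^^ j) a = a \<and> orbit_mset F j a \<subseteq># M} = count M a"
proof -
  \<comment> \<open>All iterates of a stay in the finite support of M, so two of them coincide;
    injectivity of \<open>F\<close> cancels the common part and leaves a period of a.\<close>
  have "(F ^^ i) a \<in># M" for i
    using stable_count[OF st, of i a] a by (metis count_greater_zero_iff)
  then have "finite (range (\<lambda>i. (F ^^ i) a))"
    by (meson finite_set_mset finite_subset image_subset_iff)
  then have "\<not> inj (\<lambda>i. (F ^^ i) a)"
    using finite_imageD infinite_UNIV_nat by blast
  then obtain i k where "i < k" "(F ^^ i) a = (F ^^ k) a"
    by (metis (mono_tags, lifting) injI linorder_neqE_nat)
  then have "(F ^^ i) a = (F ^^ i) ((F ^^ (k - i)) a)"
    by (metis add_diff_inverse_nat comp_apply funpow_add less_imp_not_less)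
  with \<open>i < k\<close> have ex: "k - i \<ge> 1 \<and> (F ^^ (k - i)) a = a" by (simp add: funpow_inj)
  define d where "d = (LEAST d. d \<ge> 1 \<and> (F ^^ d) a = a)"
  have d: "d \<ge> 1" "(F ^^ d) a = a" and least: "\<And>d'. d' \<ge> 1 \<Longrightarrow> (F ^^ d') a = a \<Longrightarrow> d \<le> d'"
    unfolding d_def using LeastI[of "\<lambda>d. d \<ge> 1 \<and> (F ^^ d) a = a", OF ex]
    by (auto intro: Least_le)
  have period: "(F ^^ (d * k)) a = a" for k
    by (induction k) (auto simp: funpow_add d)
  have per: "(F ^^ j) a = a \<longleftrightarrow> d dvd j" for j
  proof
    assume j: "(F ^^ j) a = a"
    have "(F ^^ (j mod d)) a = (F ^^ (j mod d)) ((F ^^ (d * (j div d))) a)"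
      by (simp add: period)
    also have "\<dots> = (F ^^ (j mod d + d * (j div d))) a"
      by (simp only: funpow_add comp_apply)
    also have "\<dots> = a" using j by simp
    finally have "j mod d = 0"
      using least[of "j mod d"] d(1) by (metis leD less_one linorder_not_less mod_less_divisor zero_less_one less_le_trans)
    then show "d dvd j" by auto
  qed (auto simp: period)
  have "inj_on (\<lambda>i. (F ^^ i) a) {..<d}"
  proof (rule linorder_inj_onI)
    fix i k assume ik: "i < k" "i \<in> {..<d}" "k \<in> {..<d}"
    have "(F ^^ k) a = (F ^^ i) ((F ^^ (k - i)) a)"
      using ik by (metis add_diff_inverse_nat comp_apply funpow_add less_imp_not_less)
    then show "(F ^^ i) a \<noteq> (F ^^ k) a"
      using ik least[of "k - i"] by (metis Suc_leI One_nat_def diff_le_self funpow_inj le_trans lessThan_iff linorder_not_less zero_less_diff)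
  qed auto
  then have O: "orbit_mset F d a = mset_set ((\<lambda>i. (F ^^ i) a) ` {..<d})"
    by (simp add: orbit_mset_def image_mset_mset_set)
  \<comment> \<open>A walk of length d k winds k times around d distinct points. Stability gives all
    these points the same multiplicity in M, so the walk fits into M exactly when k does not exceed
    it.\<close>
  have sub: "orbit_mset F (d * k) a \<subseteq># M \<longleftrightarrow> k \<le> count M a" for k
  proof
    assume "orbit_mset F (d * k) a \<subseteq># M"
    then have "count (orbit_mset F (d * k) a) a \<le> count M a" by (rule mset_subset_eq_count)
    moreover have "count (orbit_mset F d a) a = 1"
      unfolding O using d(1) by (subst count_mset_set) (auto intro!: image_eqI[of _ _ 0])
    ultimately show "k \<le> count M a" by (simp add: orbit_mset_mult[OF d(2)])
  next
    assume k: "k \<le> count M a"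
    show "orbit_mset F (d * k) a \<subseteq># M"
    proof (rule mset_subset_eqI)
      fix x
      show "count (orbit_mset F (d * k) a) x \<le> count M x"
        unfolding orbit_mset_mult[OF d(2)] O
        using k by (auto simp: count_mset_set' stable_count[OF st])
    qed
  qed
  have "{j. 1 \<le> j \<and> (F ^^ j) a = a \<and> orbit_mset F j a \<subseteq># M} = (\<lambda>k. d * k) ` {1..count M a}"
    using d(1) by (force simp: per sub dvd_def)
  also have "card \<dots> = count M a"
    using d(1) by (subst card_image) (auto simp: inj_on_def)
  finally show ?thesis .
qed

text \<open>These are closed walks of length j with a marked start, where j need not be the minimal
  period. They index the terms of the power sums in Newton's identity.\<close>

definition orbit_pairs :: "'a multiset \<Rightarrow> (nat \<times> 'a) set" where
  "orbit_pairs M = {(j, a). 1 \<le> j \<and> (F ^^ j) a = a \<and> orbit_mset F j a \<subseteq># M}"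

lemma orbit_pairs_Sigma:
  "orbit_pairs M = (\<lambda>(a, j). (j, a)) ` (SIGMA a:set_mset M. {j. 1 \<le> j \<and> (F ^^ j) a = a \<and> orbit_mset F j a \<subseteq># M})"
proof -
  have "a \<in># M" if "1 \<le> j" "orbit_mset F j a \<subseteq># M" for j a
  proof -
    have "j = Suc (j - 1)" using that(1) by simp
    then have "a \<in># orbit_mset F j a" using orbit_mset_Suc_left[of F "j - 1" a] by (metis union_single_eq_member)
    then show ?thesis using that(2) by (rule mset_subset_eqD[rotated])
  qed
  then show ?thesis
    unfolding orbit_pairs_def by (fastforce simp: image_iff)
qed

lemma finite_orbit_js: "finite {j. 1 \<le> j \<and> (F ^^ j) a = a \<and> orbit_mset F j a \<subseteq># M}"
  by (rule finite_subset[of _ "{..size M}"]) (auto dest: size_mset_mono)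

lemma finite_orbit_pairs: "finite (orbit_pairs M)"
  unfolding orbit_pairs_Sigma by (intro finite_imageI finite_SigmaI finite_set_mset finite_orbit_js)

text \<open>Each start a admits as many walks as its multiplicity in M, and the multiplicities add
  up to the size. This produces the factor n in Newton's identity.\<close>

lemma card_orbit_pairs:
  assumes "image_mset F M = M"
  shows "card (orbit_pairs M) = size M"
proof -
  have "card (orbit_pairs M) = (\<Sum>a\<in>set_mset M. card {j. 1 \<le> j \<and> (F ^^ j) a = a \<and> orbit_mset F j a \<subseteq># M})"
    unfolding orbit_pairs_Sigma
    by (subst card_image) (auto simp: inj_on_def simp del: One_nat_def intro!: card_SigmaI finite_orbit_js)
  also have "\<dots> = size M"
    using card_orbits_at[OF assms] by (simp add: size_multiset_overloaded_eq)
  finally show ?thesis .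
qed

text \<open>Every element of a stable multiset of size n starts some closed walk inside it, hence is
  fixed by an iterate \<open>F ^^ j\<close> with j at most n, and such elements are finite in
  number.\<close>

lemma finite_stable_msets: "finite (stable_msets F n)"
proof -
  let ?S = "\<Union>j\<in>{1..n}. {x. (F ^^ j) x = x}"
  have "stable_msets F n \<subseteq> mset ` {xs. set xs \<subseteq> ?S \<and> length xs = n}"
  proof
    fix M assume "M \<in> stable_msets F n"
    then have M: "image_mset F M = M" "size M = n" by (auto simp: stable_msets_def)
    have "a \<in> ?S" if "a \<in># M" for a
    proof -
      have "{j. 1 \<le> j \<and> (F ^^ j) a = a \<and> orbit_mset F j a \<subseteq># M} \<noteq> {}"
        using card_orbits_at[OF M(1) that] that by (metis card.empty count_greater_zero_iff less_numeral_extra(3))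
      then show ?thesis using M by (auto dest!: size_mset_mono)
    qed
    moreover obtain xs where "mset xs = M" using ex_mset by blast
    ultimately show "M \<in> mset ` {xs. set xs \<subseteq> ?S \<and> length xs = n}"
      using M(2) by (intro image_eqI[of _ _ xs]) (auto simp flip: size_mset)
  qed
  moreover have "finite {xs. set xs \<subseteq> ?S \<and> length xs = n}"
    by (intro finite_lists_length_eq) (auto intro: finite_fixed)
  ultimately show ?thesis by (rule finite_subset[OF _ finite_imageI])
qed

text \<open>Newton's identity relating power sums and complete symmetric functions, in the form of a
  double count of the orbit multisets contained in stable multisets.\<close>

lemma newton_identity:
  fixes w :: "'a multiset \<Rightarrow> complex"
  shows "of_nat n * (\<Sum>M\<in>stable_msets F n. w M)
    = (\<Sum>j=1..n. \<Sum>a | (F ^^ j) a = a. \<Sum>M\<in>stable_msets F (n - j). w (orbit_mset F j a + M))"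
proof -
  have "of_nat n * (\<Sum>M\<in>stable_msets F n. w M) = (\<Sum>M\<in>stable_msets F n. \<Sum>x\<in>orbit_pairs M. w M)"
    by (subst sum_distrib_left, rule sum.cong) (simp_all add: card_orbit_pairs stable_msets_def)
  also have "\<dots> = (\<Sum>(M, x)\<in>Sigma (stable_msets F n) orbit_pairs. w M)"
    by (rule sum.Sigma) (auto simp: finite_stable_msets finite_orbit_pairs)
  \<comment> \<open>Removing a closed walk of length j from a stable multiset leaves a stable
    multiset of size n - j, and adding it back is the inverse.\<close>
  also have "\<dots> = (\<Sum>((j, a), M)\<in>Sigma (SIGMA j:{1..n}. {a. (F ^^ j) a = a}) (\<lambda>(j, a). stable_msets F (n - j)). w (orbit_mset F j a + M))"
  proof (rule sum.reindex_bij_witness[of _ "\<lambda>((j, a), M). (orbit_mset F j a + M, (j, a))" "\<lambda>(M, (j, a)). ((j, a), M - orbit_mset F j a)"], goal_cases)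
    case (2 x)
    then obtain M j a where x: "x = (M, (j, a))" "M \<in> stable_msets F n" "(j, a) \<in> orbit_pairs M"
      by auto
    then obtain N where N: "M = orbit_mset F j a + N" by (auto simp: orbit_pairs_def subset_mset.le_iff_add)
    with x show ?case
      by (auto simp: orbit_pairs_def stable_msets_def orbit_mset_stable)
  next
    case (4 x)
    then show ?case by (auto simp: orbit_pairs_def stable_msets_def orbit_mset_stable)
  qed (auto simp: orbit_pairs_def stable_msets_def)
  also have "\<dots> = (\<Sum>(j, a)\<in>(SIGMA j:{1..n}. {a. (F ^^ j) a = a}). \<Sum>M\<in>stable_msets F (n - j). w (orbit_mset F j a + M))"
    by (subst sum.Sigma[symmetric]) (auto simp: finite_stable_msets finite_fixed case_prod_unfold intro!: finite_SigmaI)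
  also have "\<dots> = (\<Sum>j=1..n. \<Sum>a | (F ^^ j) a = a. \<Sum>M\<in>stable_msets F (n - j). w (orbit_mset F j a + M))"
    by (subst sum.Sigma[symmetric]) (auto simp: finite_fixed)
  finally show ?thesis .
qed

text \<open>Shifting the sum of the roots by z permutes the stable multisets, preserves the product
  condition and multiplies every weight by \<open>\<psi> z\<close>, which is not 1. From degree 2
  on, the coefficient being shifted is not the constant one. The parameters t and c carry the sum
  and product of a walk that has been split off.\<close>

lemma stable_sum_eq_0:
  fixes \<psi> :: "'a \<Rightarrow> complex"
  assumes add: "\<And>x y. F x = x \<Longrightarrow> F y = y \<Longrightarrow> \<psi> (x + y) = \<psi> x * \<psi> y"
    and z: "F z = z" "\<psi> z \<noteq> 1" and d: "d \<ge> 2" and t: "F t = t"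
  shows "(\<Sum>M\<in>stable_msets F d. if c * prod_mset M = n then \<psi> (t + sum_mset M) else 0) = 0"
    (is "sum ?w _ = 0")
proof -
  define \<tau> where "\<tau> z M = proots (root_poly M - Polynomial.monom z (d - 1))" for z :: 'a and M
  note sh = stable_msets_shift[OF d, folded \<tau>_def]
  have z': "F (- z) = - z" using z by (simp add: F_minus)
  have fs: "F (sum_mset M) = sum_mset M" if "M \<in> stable_msets F d" for M
  proof -
    have "F (sum_mset M) = sum_mset (image_mset F M)"
      by (induction M) (auto simp: F_0 F_add)
    then show ?thesis using that by (simp add: stable_msets_def)
  qed
  have "sum ?w (stable_msets F d) = (\<Sum>M\<in>stable_msets F d. \<psi> z * ?w M)"
  proof (rule sum.reindex_bij_witness[of _ "\<tau> z" "\<tau> (- z)"])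
    fix M assume M: "M \<in> stable_msets F d"
    show "\<tau> z (\<tau> (- z) M) = M" using sh(4)[OF z' M] by simp
    show "\<tau> (- z) M \<in> stable_msets F d" by (rule sh(1)[OF z' M])
    show "\<tau> (- z) (\<tau> z M) = M" "\<tau> z M \<in> stable_msets F d"
      using sh[OF z(1) M] by auto
    have "\<psi> (t + sum_mset M) = \<psi> (t + sum_mset (\<tau> (- z) M) + z)" 
      using sh(2)[OF z' M] by simp
    also have "\<dots> = \<psi> z * \<psi> (t + sum_mset (\<tau> (- z) M))"
      using add[of "t + sum_mset (\<tau> (- z) M)" z] fs[OF sh(1)[OF z' M]] z t by (simp add: F_add)
    finally show "\<psi> z * ?w (\<tau> (- z) M) = ?w M"
      using sh(3)[OF z' M] by simp
  qed
  also have "\<dots> = \<psi> z * sum ?w (stable_msets F d)" by (simp add: sum_distrib_left)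
  finally show ?thesis using z(2) by simp
qed

text \<open>Newton's identity in degree L + 1 has left side 0, and on the right every cofactor of
  degree at least 2 sums to 0. Only j = L and j = L + 1 survive and must cancel. Fixing the norm n
  takes the place of a multiplicative character, so no Gauss sums are needed.\<close>

theorem hasse_davenport_step:
  fixes \<psi> :: "'a \<Rightarrow> complex"
  assumes add: "\<And>x y. F x = x \<Longrightarrow> F y = y \<Longrightarrow> \<psi> (x + y) = \<psi> x * \<psi> y"
    and z: "F z = z" "\<psi> z \<noteq> 1" and L: "L \<ge> 1"
  defines "Tr \<equiv> \<lambda>j a. \<Sum>i<j. (F ^^ i) a" and "Nm \<equiv> \<lambda>j a. \<Prod>i<j. (F ^^ i) a"
  shows "(\<Sum>b | (F ^^ Suc L) b = b. if Nm (Suc L) b = n then \<psi> (Tr (Suc L) b) else 0)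
    = - (\<Sum>a | (F ^^ L) a = a. \<Sum>y | F y = y. if Nm L a * y = n then \<psi> (Tr L a + y) else 0)"
proof -
  define w where "w M = (if prod_mset M = n then \<psi> (sum_mset M) else 0)" for M
  have TN: "sum_mset (orbit_mset F j a) = Tr j a" "prod_mset (orbit_mset F j a) = Nm j a" for j a
    by (simp_all add: orbit_mset_def Tr_def Nm_def sum_unfold_sum_mset prod_unfold_prod_mset)
  have FTr: "F (Tr j a) = Tr j a" if "(F ^^ j) a = a" for j a
  proof -
    have "F (sum_mset M) = sum_mset (image_mset F M)" for M
      by (induction M) (auto simp: F_0 F_add)
    then show ?thesis using orbit_mset_stable[of j F a, OF that] by (metis TN(1))
  qed
  have vanish: "(\<Sum>M\<in>stable_msets F d. if c * prod_mset M = n then \<psi> (t + sum_mset M) else 0) = 0"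
    if "d \<ge> 2" "F t = t" for d t c
    using add z that by (rule stable_sum_eq_0[where \<psi> = \<psi> and z = z])
  let ?g = "\<lambda>j. \<Sum>a | (F ^^ j) a = a. \<Sum>M\<in>stable_msets F (Suc L - j). w (orbit_mset F j a + M)"
  have "(\<Sum>M\<in>stable_msets F (Suc L). w M) = 0"
    using vanish[of "Suc L" 0 1] L by (simp add: F_0 w_def cong: if_cong)
  then have "0 = of_nat (Suc L) * (\<Sum>M\<in>stable_msets F (Suc L). w M)" by (simp only: mult_zero_right)
  also have "\<dots> = (\<Sum>j=1..Suc L. ?g j)" by (rule newton_identity)
  also have "\<dots> = (\<Sum>j\<in>{L, Suc L}. ?g j)"
  proof (rule sum.mono_neutral_right)
    show "\<forall>j\<in>{1..Suc L} - {L, Suc L}. ?g j = 0"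
    proof
      fix j assume "j \<in> {1..Suc L} - {L, Suc L}"
      then have "Suc L - j \<ge> 2" by auto
      then have "(\<Sum>M\<in>stable_msets F (Suc L - j). w (orbit_mset F j a + M)) = 0" if "(F ^^ j) a = a" for a
        using vanish[OF _ FTr[OF that], of "Suc L - j" "Nm j a"]
        by (simp add: w_def TN cong: if_cong)
      then show "?g j = 0" by (intro sum.neutral) auto
    qed
  qed (use L in auto)
  also have "\<dots> = ?g L + ?g (Suc L)" by simp
  \<comment> \<open>The surviving cofactors have degree 0 and 1: the empty multiset, and singletons
    of fixed points, which supply the summation over y.\<close>
  also have "stable_msets F (Suc L - Suc L) = {{#}}" by (auto simp: stable_msets_def)
  also have "stable_msets F (Suc L - L) = (\<lambda>y. {#y#}) ` {y. F y = y}"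
    by (auto simp: stable_msets_def dest!: size_1_singleton_mset[unfolded One_nat_def])
  finally show ?thesis
    by (simp add: sum.reindex inj_on_def w_def TN eq_neg_iff_add_eq_0 add.commute mult.commute cong: if_cong)
qed

end

section \<open>Elementary abelian groups and additive characters\<close>

lemma (in group) int_pow_mod:
  assumes x: "x \<in> carrier G" and p: "x [^] (p::nat) = \<one>"
  shows "x [^] (z mod int p) = x [^] (z::int)"
proof -
  have "x [^] z = x [^] (int p * (z div int p) + z mod int p)" by simp
  also have "\<dots> = x [^] (int p * (z div int p)) \<otimes> x [^] (z mod int p)"
    using x by (rule int_pow_mult)
  also have "x [^] (int p * (z div int p)) = (x [^] int p) [^] (z div int p)"
    using x by (simp add: int_pow_pow)
  also have "x [^] int p = \<one>" using p by (simp add: int_pow_int)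
  finally show ?thesis using x by simp
qed

lemma (in group) mem_subgroup_of_pow:
  assumes H: "subgroup H G" and x: "x \<in> carrier G" and p: "prime p" "x [^] (p::nat) = \<one>"
    and a: "0 < a" "a < int p" and xa: "x [^] a \<in> H"
  shows "x \<in> H"
proof -
  have "coprime a (int p)"
    using a p by (metis coprime_commute prime_imp_coprime prime_nat_int_transfer zdvd_not_zless)
  then obtain u v where uv: "u * a + v * int p = 1"
    using bezout_int[of a "int p"] by auto
  have "x = x [^] (a * u + int p * v)" using uv x by (simp add: mult.commute)
  also have "\<dots> = (x [^] a) [^] u \<otimes> (x [^] int p) [^] v"
    using x by (simp add: int_pow_mult int_pow_pow)
  also have "x [^] int p = \<one>" using p by (simp add: int_pow_int)
  finally have "x = (x [^] a) [^] u" using x by simp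
  also have "\<dots> \<in> H" using xa H
    by (simp add: subgroup_int_pow_closed)
  finally show ?thesis .
qed

text \<open>An embedding of the k-fold power of the cyclic group of order p is extended one
  coordinate at a time: for k < n its image is too small to be everything, and any element outside
  serves as the next generator. At k = n, counting forces surjectivity.\<close>

theorem (in comm_group) elementary_abelian_iso:
  assumes fin: "finite (carrier G)" and card: "card (carrier G) = p ^ n" and p: "prime p"
    and exp: "\<And>x. x \<in> carrier G \<Longrightarrow> x [^] (p::nat) = \<one>"
  shows "G \<cong> product_group {..<n} (\<lambda>_. integer_mod_group p)"
proof -
  define P where "P k = product_group {..<k::nat} (\<lambda>_. integer_mod_group p)" for k
  have grP: "group (P k)" for k by (simp add: P_def)
  have p0: "p > 0" using p prime_gt_0_nat by blast
  have cP: "carrier (P k) = {..<k} \<rightarrow>\<^sub>E {0..<int p}" for k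
    using p0 by (simp add: P_def carrier_integer_mod_group)
  have finP: "finite (carrier (P k))" and cardP: "card (carrier (P k)) = p ^ k" for k
    unfolding cP by (auto simp: finite_PiE card_PiE)
  have multP: "f \<otimes>\<^bsub>P k\<^esub> g = (\<lambda>i\<in>{..<k}. (f i + g i) mod int p)" for f g k
    by (simp add: P_def)
  have "\<exists>\<phi>. \<phi> \<in> hom (P k) G \<and> inj_on \<phi> (carrier (P k))" if "k \<le> n" for k
    using that
  proof (induction k)
    case 0
    have "(\<lambda>_. \<one>) \<in> hom (P 0) G" by (auto simp: hom_def)
    moreover have "inj_on (\<lambda>_. \<one>) (carrier (P 0))" by (auto simp: cP)
    ultimately show ?case by blast
  next
    case (Suc k)
    then obtain \<phi> where \<phi>: "\<phi> \<in> hom (P k) G" "inj_on \<phi> (carrier (P k))" by auto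
    interpret \<phi>: group_hom "P k" G \<phi>
      using \<phi>(1) grP by (simp add: group_hom_def group_hom_axioms_def)
    let ?H = "\<phi> ` carrier (P k)"
    have H: "subgroup ?H G" by (rule \<phi>.img_is_subgroup)
    have "card ?H = p ^ k" using \<phi>(2) by (simp add: card_image cardP)
    also have "\<dots> < card (carrier G)" unfolding card using Suc.prems p prime_gt_1_nat
      by (intro power_strict_increasing) auto
    finally have "\<not> carrier G \<subseteq> ?H"
      using finP by (metis card_mono finite_imageI not_less)
    then obtain x where x: "x \<in> carrier G" "x \<notin> ?H" by blast
    \<comment> \<open>The new coordinate has index k and acts through powers of x;
      \<open>restrict\<close> forgets it before \<open>\<phi>\<close> is applied.\<close>
    define \<phi>' where "\<phi>' f = \<phi> (restrict f {..<k}) \<otimes> x [^] (f k :: int)" for f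
    have res: "restrict f {..<k} \<in> carrier (P k)" if "f \<in> carrier (P (Suc k))" for f
      using that PiE_mem[of f "{..<Suc k}"] unfolding cP restrict_PiE_iff by fastforce
    have hom: "\<phi>' \<in> hom (P (Suc k)) G"
    proof (rule homI)
      fix f g assume f: "f \<in> carrier (P (Suc k))" and g: "g \<in> carrier (P (Suc k))"
      show "\<phi>' f \<in> carrier G" using res[OF f] x by (simp add: \<phi>'_def)
      have "restrict (f \<otimes>\<^bsub>P (Suc k)\<^esub> g) {..<k} = restrict f {..<k} \<otimes>\<^bsub>P k\<^esub> restrict g {..<k}"
        by (auto simp: multP fun_eq_iff)
      moreover have "x [^] ((f \<otimes>\<^bsub>P (Suc k)\<^esub> g) k) = x [^] f k \<otimes> x [^] g k"
        using x by (simp add: multP int_pow_mod exp int_pow_mult)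
      ultimately show "\<phi>' (f \<otimes>\<^bsub>P (Suc k)\<^esub> g) = \<phi>' f \<otimes> \<phi>' g"
        using res[OF f] res[OF g] x by (simp add: \<phi>'_def m_ac)
    qed
    interpret \<phi>': group_hom "P (Suc k)" G \<phi>'
      using hom grP by (simp add: group_hom_def group_hom_axioms_def)
    have "inj_on \<phi>' (carrier (P (Suc k)))"
    proof (subst \<phi>'.inj_on_one_iff, intro ballI impI allI)
      fix f assume f: "f \<in> carrier (P (Suc k))" and 1: "\<phi>' f = \<one>"
      have fk: "0 \<le> f k" "f k < int p" using PiE_mem[of f "{..<Suc k}" _ k] f unfolding cP by fastforce+
      have inv: "x [^] f k = inv (\<phi> (restrict f {..<k}))"
        using 1 res[OF f] x unfolding \<phi>'_def
        by (intro inv_equality[symmetric]) (auto simp: m_comm)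
      \<comment> \<open>A kernel element makes a power of x fall into the old image. A nonzero
        exponent below p would then put x itself there, against its choice.\<close>
      have "x [^] f k \<in> ?H"
        unfolding inv using H res[OF f] by (simp add: subgroup.m_inv_closed)
      then have fk0: "f k = 0"
        using mem_subgroup_of_pow[OF H x(1) p exp[OF x(1)], of "f k"] fk x(2) by linarith
      then have "\<phi> (restrict f {..<k}) = \<one>" using 1 res[OF f] by (simp add: \<phi>'_def)
      then have "restrict f {..<k} = \<one>\<^bsub>P k\<^esub>"
        using \<phi>(2) res[OF f] by (simp add: \<phi>.inj_on_one_iff)
      then have "\<forall>i<k. f i = 0" by (auto simp: P_def fun_eq_iff restrict_def split: if_splits)
      with fk0 have "\<forall>i<Suc k. f i = 0" by (simp add: less_Suc_eq)
      moreover have "f \<in> extensional {..<Suc k}" using f unfolding cP by (simp add: PiE_def)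
      ultimately show "f = \<one>\<^bsub>P (Suc k)\<^esub>"
        by (auto simp: P_def fun_eq_iff extensional_def)
    qed
    with hom show ?case by blast
  qed
  then obtain \<phi> where \<phi>: "\<phi> \<in> hom (P n) G" "inj_on \<phi> (carrier (P n))" by auto
  have "\<phi> ` carrier (P n) \<subseteq> carrier G" using \<phi>(1) by (auto simp: hom_def)
  moreover have "card (\<phi> ` carrier (P n)) = card (carrier G)"
    using \<phi>(2) by (simp add: card_image cardP card)
  ultimately have "\<phi> ` carrier (P n) = carrier G" using fin by (simp add: card_subset_eq)
  with \<phi> have "\<phi> \<in> iso (P n) G" by (simp add: iso_def bij_betw_def)
  then have "P n \<cong> G" by (auto simp: is_iso_def)
  then show ?thesis unfolding P_def[symmetric] using grP group.iso_sym by blast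
qed

lemma subfield_facts:
  fixes F :: "'f::field set"
  assumes "subfield F (ring_of_type_algebra :: 'f ring)"
  shows subfield_0: "0 \<in> F" and subfield_1: "1 \<in> F"
    and subfield_add: "\<And>x y. x \<in> F \<Longrightarrow> y \<in> F \<Longrightarrow> x + y \<in> F"
    and subfield_mult: "\<And>x y. x \<in> F \<Longrightarrow> y \<in> F \<Longrightarrow> x * y \<in> F"
    and subfield_uminus: "\<And>x. x \<in> F \<Longrightarrow> - x \<in> F"
proof -
  interpret R: field "ring_of_type_algebra :: 'f ring" by (rule field_from_type_algebra)
  have s: "subring F (ring_of_type_algebra :: 'f ring)" using assms by (rule subfieldE(1))
  have [simp]: "\<one>\<^bsub>ring_of_type_algebra\<^esub> = (1::'f)" "\<zero>\<^bsub>ring_of_type_algebra\<^esub> = (0::'f)"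
    "\<And>x y. x \<oplus>\<^bsub>ring_of_type_algebra\<^esub> y = x + (y::'f)" "\<And>x y. x \<otimes>\<^bsub>ring_of_type_algebra\<^esub> y = x * (y::'f)"
    "carrier ring_of_type_algebra = (UNIV :: 'f set)"
    by (auto simp: ring_of_type_algebra_def)
  have [simp]: "\<ominus>\<^bsub>ring_of_type_algebra\<^esub> x = - (x::'f)" for x
    using R.minus_equality[of "- x" x] by simp
  show "0 \<in> F" "1 \<in> F" using subringE(2,3)[OF s] by auto
  show "x + y \<in> F" "x * y \<in> F" if "x \<in> F" "y \<in> F" for x y
    using subringE(6,7)[OF s] that by auto
  show "- x \<in> F" if "x \<in> F" for x using subringE(5)[OF s that] by simp
qed

lemma additive_group_simps [simp]:
  "carrier (additive_group F) = F" "x \<otimes>\<^bsub>additive_group F\<^esub> y = x + y" "\<one>\<^bsub>additive_group F\<^esub> = 0"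
  by (simp_all add: additive_group_def)

lemma comm_group_additive_group:
  assumes "0 \<in> F" "\<And>x y. x \<in> F \<Longrightarrow> y \<in> F \<Longrightarrow> x + y \<in> F" "\<And>x. x \<in> F \<Longrightarrow> - x \<in> F"
  shows "comm_group (additive_group F)"
  using assms by (intro comm_groupI) (auto simp: algebra_simps intro!: bexI[of _ "- _"])

lemma inv_additive_group:
  assumes "comm_group (additive_group F)" "x \<in> F" "- x \<in> F"
  shows "inv\<^bsub>additive_group F\<^esub> x = - x"
proof -
  interpret comm_group "additive_group F" by fact
  show ?thesis using assms by (intro inv_equality) auto
qed

lemma pow_additive_group: "x [^]\<^bsub>additive_group F\<^esub> (n::nat) = of_nat n * x"
  by (induction n) (auto simp: nat_pow_def algebra_simps)

text \<open>Coordinate 0 of an isomorphism with a power of the integers modulo p, turned into a p-th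
  root of unity; n at least 1 guarantees that this coordinate exists.\<close>

lemma ex_additive_character:
  fixes F :: "'f::field set"
  assumes gr: "comm_group (additive_group F)" and fin: "finite F" and card: "card F = p ^ n"
    and p: "prime p" "of_nat p = (0::'f)" and n: "n \<ge> 1"
  obtains \<psi> :: "'f \<Rightarrow> complex" where "\<And>x y. x \<in> F \<Longrightarrow> y \<in> F \<Longrightarrow> \<psi> (x + y) = \<psi> x * \<psi> y" "\<psi> 0 = 1" "\<exists>z\<in>F. \<psi> z \<noteq> 1"
proof -
  interpret comm_group "additive_group F" by fact
  have "additive_group F \<cong> product_group {..<n} (\<lambda>_. integer_mod_group p)"
    using fin card p by (intro elementary_abelian_iso) (auto simp: pow_additive_group)
  then obtain f where f: "f \<in> iso (additive_group F) (product_group {..<n} (\<lambda>_. integer_mod_group p))"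
    by (auto simp: is_iso_def)
  have p1: "p > 1" using p prime_gt_1_nat by blast
  define \<psi> where "\<psi> x = cis (2 * pi * of_int (f x 0) / real p)" for x
  \<comment> \<open>Coordinates add only modulo p, and the root of unity does not see the
    reduction.\<close>
  have per: "cis (2 * pi * of_int (a mod int p) / real p) = cis (2 * pi * of_int a / real p)" for a
  proof -
    have "(of_int a :: real) = of_int (a div int p) * real p + of_int (a mod int p)"
      by (metis div_mult_mod_eq of_int_add of_int_mult of_int_of_nat_eq)
    then have "2 * pi * of_int a / real p = 2 * pi * of_int (a div int p) + 2 * pi * of_int (a mod int p) / real p"
      using p1 by (simp add: field_simps)
    then show ?thesis by (simp add: cis_multiple_2pi flip: cis_mult)
  qed
  have "\<psi> (x + y) = \<psi> x * \<psi> y" if "x \<in> F" "y \<in> F" for x y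
  proof -
    have "f (x + y) = f x \<otimes>\<^bsub>product_group {..<n} (\<lambda>_. integer_mod_group p)\<^esub> f y"
      using f that by (auto simp: iso_def hom_def)
    then have "f (x + y) 0 = (f x 0 + f y 0) mod int p" using n by auto
    then show ?thesis by (simp add: \<psi>_def per cis_mult add_divide_distrib ring_distribs)
  qed
  moreover from this[of 0 0] have "\<psi> 0 = 1" using one_closed by (simp add: \<psi>_def)
  moreover have "\<exists>z\<in>F. \<psi> z \<noteq> 1"
  proof -
    \<comment> \<open>A preimage of this unit vector is sent to the root of unity with angle 2 pi /
      p, which differs from 1 since p > 1.\<close>
    let ?g = "\<lambda>i\<in>{..<n}. if i = 0 then 1 else 0 :: int"
    have "?g \<in> carrier (product_group {..<n} (\<lambda>_. integer_mod_group p))"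
      using p1 by (auto simp: carrier_integer_mod_group)
    moreover have "f ` F = carrier (product_group {..<n} (\<lambda>_. integer_mod_group p))"
      using f by (simp add: iso_def bij_betw_def)
    ultimately have "?g \<in> f ` F" by (simp only:)
    then obtain z where z: "z \<in> F" "f z = ?g" by (metis imageE)
    have "\<psi> z = cis (2 * pi / real p)" using z n by (simp add: \<psi>_def)
    moreover have "cis (2 * pi / real p) \<noteq> 1"
    proof
      assume "cis (2 * pi / real p) = 1"
      then have "cos (2 * pi / real p) = 1" by (auto simp: complex_eq_iff)
      then obtain k :: int where "2 * pi / real p = of_int k * 2 * pi"
        using cos_one_2pi_int by auto
      then have "1 = of_int k * real p" using p1 by (simp add: field_simps)
      then have "1 = k * int p" by (metis of_int_1 of_int_eq_iff of_int_mult of_int_of_nat_eq)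
      then show False using p1 by (simp add: zmult_eq_1_iff eq_commute[of 1])
    qed
    ultimately show ?thesis using z(1) by metis
  qed
  ultimately show ?thesis using that by blast
qed

section \<open>Cayley graphs of partial difference sets\<close>

lemma Cay_simps [simp]:
  "pverts (Cay G D) = carrier G"
  "(g, h) \<in> parcs (Cay G D) \<longleftrightarrow> g \<in> carrier G \<and> h \<in> carrier G \<and> g \<otimes>\<^bsub>G\<^esub> inv\<^bsub>G\<^esub> h \<in> D"
  by (auto simp: Cay_def)

context comm_group
begin

lemma inv_mult_inv:
  assumes "x \<in> carrier G" "y \<in> carrier G"
  shows "inv (x \<otimes> inv y) = y \<otimes> inv x"
  using assms by (simp add: inv_mult m_comm)

lemma mult_inv_mult_cancel:
  assumes "x \<in> carrier G" "g \<in> carrier G"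
  shows "x \<otimes> inv (inv g \<otimes> x) = g"
proof -
  have "x \<otimes> inv (inv g \<otimes> x) = x \<otimes> (inv x \<otimes> g)"
    using assms by (simp add: inv_mult m_comm)
  also have "\<dots> = g" using assms by (simp flip: m_assoc)
  finally show ?thesis .
qed

lemma diff_diff_cancel:
  assumes "x \<in> carrier G" "y \<in> carrier G" "z \<in> carrier G"
  shows "(x \<otimes> inv z) \<otimes> inv (y \<otimes> inv z) = x \<otimes> inv y"
proof -
  have "(x \<otimes> inv z) \<otimes> inv (y \<otimes> inv z) = x \<otimes> (inv z \<otimes> (z \<otimes> inv y))"
    using assms by (simp add: inv_mult_inv m_assoc)
  also have "\<dots> = x \<otimes> inv y" using assms by (simp flip: m_assoc)
  finally show ?thesis .
qed

text \<open>A common neighbour z corresponds to the pair of its differences to x and to y: their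
  quotient does not involve z, and z is recovered from the first component g as
  \<open>inv g \<otimes> x\<close>.\<close>

lemma card_Cay_common_neighbours:
  assumes D: "D \<subseteq> carrier G" and x: "x \<in> carrier G" and y: "y \<in> carrier G" and "x \<noteq> y"
  shows "card {z \<in> pverts (Cay G D). (x, z) \<in> parcs (Cay G D) \<and> (y, z) \<in> parcs (Cay G D)}
    = card {(g, h). g \<in> D \<and> h \<in> D \<and> g \<noteq> h \<and> g \<otimes> inv h = x \<otimes> inv y}"
proof (rule bij_betw_same_card[of "\<lambda>z. (x \<otimes> inv z, y \<otimes> inv z)"], rule bij_betw_byWitness[where f' = "\<lambda>(g, h). inv g \<otimes> x"])
  show "\<forall>z\<in>{z \<in> pverts (Cay G D). (x, z) \<in> parcs (Cay G D) \<and> (y, z) \<in> parcs (Cay G D)}.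
      (case (x \<otimes> inv z, y \<otimes> inv z) of (g, h) \<Rightarrow> inv g \<otimes> x) = z"
  proof
    fix z assume "z \<in> {z \<in> pverts (Cay G D). (x, z) \<in> parcs (Cay G D) \<and> (y, z) \<in> parcs (Cay G D)}"
    then have z: "z \<in> carrier G" by simp
    have "inv (x \<otimes> inv z) \<otimes> x = z \<otimes> (inv x \<otimes> x)" using x z by (simp add: inv_mult_inv m_assoc)
    then show "(case (x \<otimes> inv z, y \<otimes> inv z) of (g, h) \<Rightarrow> inv g \<otimes> x) = z" using x z by simp
  qed
  have *: "y \<otimes> inv (inv g \<otimes> x) = h" if g: "g \<in> carrier G" and h: "h \<in> carrier G" and gh: "g \<otimes> inv h = x \<otimes> inv y" for g h
  proof -
    have "y \<otimes> inv (inv g \<otimes> x) = (y \<otimes> inv x) \<otimes> g"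
      using x y g by (simp add: inv_mult m_ac)
    also have "y \<otimes> inv x = h \<otimes> inv g"
      using arg_cong[OF gh, of "m_inv G"] g h x y by (simp only: inv_mult_inv)
    also have "h \<otimes> inv g \<otimes> g = h" using g h by (simp add: m_assoc)
    finally show ?thesis .
  qed
  show "\<forall>p\<in>{(g, h). g \<in> D \<and> h \<in> D \<and> g \<noteq> h \<and> g \<otimes> inv h = x \<otimes> inv y}.
      (x \<otimes> inv (case p of (g, h) \<Rightarrow> inv g \<otimes> x), y \<otimes> inv (case p of (g, h) \<Rightarrow> inv g \<otimes> x)) = p"
    using D x * by (auto simp: mult_inv_mult_cancel subset_iff)
  show "(\<lambda>z. (x \<otimes> inv z, y \<otimes> inv z)) ` {z \<in> pverts (Cay G D). (x, z) \<in> parcs (Cay G D) \<and> (y, z) \<in> parcs (Cay G D)}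
      \<subseteq> {(g, h). g \<in> D \<and> h \<in> D \<and> g \<noteq> h \<and> g \<otimes> inv h = x \<otimes> inv y}"
    using x y \<open>x \<noteq> y\<close> by (auto simp: diff_diff_cancel)
  show "(\<lambda>(g, h). inv g \<otimes> x) ` {(g, h). g \<in> D \<and> h \<in> D \<and> g \<noteq> h \<and> g \<otimes> inv h = x \<otimes> inv y}
      \<subseteq> {z \<in> pverts (Cay G D). (x, z) \<in> parcs (Cay G D) \<and> (y, z) \<in> parcs (Cay G D)}"
    using D x y * by (auto simp: mult_inv_mult_cancel subset_iff)
qed

text \<open>Closure of D under inverses makes the arcs symmetric and the missing identity excludes
  loops. The counts of common neighbours are then difference counts at
  \<open>x \<otimes> inv y\<close>.\<close>

theorem strongly_regular_Cay:
  assumes pds: "partial_difference_set G D v k lam mu" and sym: "\<And>x. x \<in> D \<Longrightarrow> inv x \<in> D"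
  shows "strongly_regular_graph (Cay G D) v k lam mu"
proof -
  have fin: "finite (carrier G)" and D: "D \<subseteq> carrier G" and "card D = k" and 1: "\<one> \<notin> D"
    and lam: "\<And>x. x \<in> D \<Longrightarrow> card {(g, h). g \<in> D \<and> h \<in> D \<and> g \<noteq> h \<and> g \<otimes> inv h = x} = lam"
    and mu: "\<And>x. x \<in> carrier G \<Longrightarrow> x \<notin> D \<Longrightarrow> x \<noteq> \<one> \<Longrightarrow> card {(g, h). g \<in> D \<and> h \<in> D \<and> g \<noteq> h \<and> g \<otimes> inv h = x} = mu"
    using pds by (auto simp: partial_difference_set_def)
  have neq: "x \<otimes> inv y \<noteq> \<one>" if "x \<in> carrier G" "y \<in> carrier G" "x \<noteq> y" for x y
    using that by (metis inv_closed inv_equality inv_inv)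
  have "pair_graph (Cay G D)"
  proof
    show "finite (parcs (Cay G D))"
      by (rule finite_subset[of _ "carrier G \<times> carrier G"]) (use fin in \<open>auto simp: Cay_def\<close>)
    show "symmetric (with_proj (Cay G D))"
    proof -
      have "(h, g) \<in> parcs (Cay G D)" if "(g, h) \<in> parcs (Cay G D)" for g h
        using that sym[of "g \<otimes> inv h"] by (auto simp: inv_mult_inv)
      then show ?thesis by (auto simp: symmetric_def sym_def)
    qed
  qed (use fin 1 in \<open>auto simp: Cay_def\<close>)
  moreover have "card {z \<in> carrier G. (x, z) \<in> parcs (Cay G D)} = k" if x: "x \<in> carrier G" for x
  proof -
    have "bij_betw (\<lambda>z. x \<otimes> inv z) {z \<in> carrier G. (x, z) \<in> parcs (Cay G D)} D"
    proof (rule bij_betw_byWitness[where f' = "\<lambda>g. inv g \<otimes> x"])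
      show "\<forall>z\<in>{z \<in> carrier G. (x, z) \<in> parcs (Cay G D)}. inv (x \<otimes> inv z) \<otimes> x = z"
        using x by (auto simp: inv_mult_inv m_assoc)
    qed (use x D in \<open>auto simp: mult_inv_mult_cancel subset_iff\<close>)
    then show ?thesis using \<open>card D = k\<close> bij_betw_same_card by blast
  qed
  moreover have "card {z \<in> pverts (Cay G D). (x, z) \<in> parcs (Cay G D) \<and> (y, z) \<in> parcs (Cay G D)} = lam"
    if "x \<in> carrier G" "y \<in> carrier G" "(x, y) \<in> parcs (Cay G D)" for x y
  proof -
    have "x \<noteq> y" using that 1 by auto
    from card_Cay_common_neighbours[OF D that(1,2) this] show ?thesis
      using lam[of "x \<otimes> inv y"] that by simp
  qed
  moreover have "card {z \<in> pverts (Cay G D). (x, z) \<in> parcs (Cay G D) \<and> (y, z) \<in> parcs (Cay G D)} = mu"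
    if "x \<in> carrier G" "y \<in> carrier G" "x \<noteq> y" "(x, y) \<notin> parcs (Cay G D)" for x y
    using card_Cay_common_neighbours[OF D that(1-3)] mu[of "x \<otimes> inv y"] neq[OF that(1-3)] that by simp
  ultimately show ?thesis
    using pds by (auto simp: strongly_regular_graph_def partial_difference_set_def)
qed

end

section \<open>Trace and norm\<close>

text \<open>Both \<open>Tr\<close> and \<open>Nm\<close> are written over the conjugates
  \<open>x ^ Q ^ i\<close>, the form in which \<open>hasse_davenport_step\<close> produces
  them.\<close>

definition Tr :: "nat \<Rightarrow> nat \<Rightarrow> 'a::field \<Rightarrow> 'a" where
  "Tr Q n x = (\<Sum>i<n. x ^ Q ^ i)"

definition Nm :: "nat \<Rightarrow> nat \<Rightarrow> 'a::field \<Rightarrow> 'a" where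
  "Nm Q n x = (\<Prod>i<n. x ^ Q ^ i)"

lemma card_roots_le:
  fixes f :: "'a::idom poly"
  assumes "f \<noteq> 0" and "\<And>x. x \<in> S \<Longrightarrow> poly f x = 0"
  shows "finite S" "card S \<le> Polynomial.degree f"
proof -
  have "S \<subseteq> {x. poly f x = 0}" using assms(2) by auto
  then show "finite S" using poly_roots_finite[OF assms(1)] finite_subset by blast
  show "card S \<le> Polynomial.degree f"
    using \<open>S \<subseteq> _\<close> card_poly_roots_bound[OF assms(1)] poly_roots_finite[OF assms(1)]
    by (meson card_mono le_trans)
qed

lemma fixed_points_finite:
  assumes "N \<ge> 2"
  shows "finite {x::'a::field. x ^ N = x}" "card {x::'a::field. x ^ N = x} \<le> N"
proof -
  let ?f = "Polynomial.monom 1 N - [:0, 1:] :: 'a poly"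
  have "Polynomial.coeff ?f N = 1" using assms by (auto simp: coeff_pCons split: nat.splits)
  then have nz: "?f \<noteq> 0" by (metis coeff_0 zero_neq_one)
  have "Polynomial.degree ?f \<le> N"
    using assms by (intro degree_diff_le) (auto simp: degree_monom_le)
  moreover have "poly ?f x = 0" if "x \<in> {x. x ^ N = x}" for x using that by (simp add: poly_monom)
  ultimately show "finite {x::'a. x ^ N = x}" "card {x::'a. x ^ N = x} \<le> N"
    using card_roots_le[OF nz, of "{x. x ^ N = x}"] by (blast, meson le_trans)
qed

lemma card_power_eq_le:
  assumes "N \<ge> 1"
  shows "card {x::'a::field. x ^ N = c} \<le> N"
proof -
  let ?f = "Polynomial.monom 1 N - [:c:] :: 'a poly"
  have "Polynomial.coeff ?f N = 1" using assms by (auto simp: coeff_pCons split: nat.splits)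
  then have nz: "?f \<noteq> 0" by (metis coeff_0 zero_neq_one)
  have "Polynomial.degree ?f \<le> N"
    using assms by (intro degree_diff_le) (auto simp: degree_monom_le)
  moreover have "poly ?f x = 0" if "x \<in> {x. x ^ N = c}" for x using that by (simp add: poly_monom)
  ultimately show ?thesis
    using card_roots_le[OF nz, of "{x. x ^ N = c}"] by (meson le_trans)
qed

lemma geometric_sum_mult: "(Q - 1) * (\<Sum>i<n. Q ^ i) = Q ^ n - (1::nat)"
proof (induction n)
  case (Suc n)
  show ?case
  proof (cases "Q = 0")
    case False
    then have "Q ^ n \<ge> 1" "Q \<ge> 1" by auto
    with Suc show ?thesis by (simp add: distrib_left diff_mult_distrib)
  qed simp
qed simp

lemma Nm_eq_power: "Nm Q n x = x ^ (\<Sum>i<n. Q ^ i)"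
  by (simp add: Nm_def power_sum)

lemma Nm_eq_power_div:
  assumes "Q \<ge> 2"
  shows "Nm Q n x = x ^ ((Q ^ n - 1) div (Q - 1))"
proof -
  have "(Q ^ n - 1) div (Q - 1) = (\<Sum>i<n. Q ^ i)"
    unfolding geometric_sum_mult[of Q n, symmetric] using assms by simp
  then show ?thesis by (simp add: Nm_eq_power)
qed

lemma Nm_mult: "Nm Q n (x * y) = Nm Q n x * Nm Q n y"
  by (simp add: Nm_def power_mult_distrib prod.distrib)

lemma Nm_eq_0_iff: "n \<ge> 1 \<Longrightarrow> Nm Q n x = 0 \<longleftrightarrow> x = 0"
  by (auto simp: Nm_def prod_zero_iff intro!: bexI[of _ 0])

text \<open>K, A and B have degrees 1, L and L + 1 over the field of order Q. Each is given as a
  fixed-point set, which yields closure properties from the Frobenius map, together with its order,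
  which says that all roots of the defining equation already lie in the ambient field.\<close>

locale field_tower =
  fixes Q L p t :: nat and K A B :: "'f::field set" and \<psi> :: "'f \<Rightarrow> complex"
  assumes p: "prime p" "CHAR('f) = p" and Q: "Q = p ^ t" "t \<ge> 1" and L: "L \<ge> 1"
    and K_def: "K = {x. x ^ Q = x}" and card_K: "card K = Q"
    and A_def: "A = {x. x ^ (Q ^ L) = x}" and card_A: "card A = Q ^ L"
    and B_def: "B = {x. x ^ (Q ^ Suc L) = x}" and card_B: "card B = Q ^ Suc L"
    and \<psi>_add: "\<And>x y. x \<in> K \<Longrightarrow> y \<in> K \<Longrightarrow> \<psi> (x + y) = \<psi> x * \<psi> y"
    and \<psi>_0: "\<psi> 0 = 1" and \<psi>_nontrivial: "\<exists>z\<in>K. \<psi> z \<noteq> 1"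
begin

lemma Q2: "Q \<ge> 2"
proof -
  have "p \<ge> 2" using p by (simp add: prime_ge_2_nat)
  then show ?thesis unfolding Q using self_le_power[of p t] Q(2) by linarith
qed

lemma Q_power_ge_2: "n \<ge> 1 \<Longrightarrow> Q ^ n \<ge> 2"
  using Q2 self_le_power[of Q n] by linarith

lemma frob_add: "(x + y :: 'f) ^ (Q ^ n) = x ^ (Q ^ n) + y ^ (Q ^ n)"
  by (rule freshmans_dream'[where n = "t * n"]) (use p Q in \<open>auto simp: power_mult\<close>)

lemma frob_sum: "(\<Sum>i\<in>I. f i :: 'f) ^ (Q ^ n) = (\<Sum>i\<in>I. f i ^ (Q ^ n))"
  by (rule freshmans_dream_sum'[where n = "t * n"]) (use p Q in \<open>auto simp: power_mult\<close>)

lemma finite_K: "finite K" and finite_A: "finite A" and finite_B: "finite B"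
  using Q2 card_K card_A card_B by (auto intro!: card_ge_0_finite)

text \<open>The equation \<open>x ^ N = x\<close> has at most N solutions in any field. The ambient
  field already contains N of them, so passing to the algebraic closure adds none.\<close>

lemma to_ac_fixed_points:
  assumes "card {x::'f. x ^ N = x} = N" "N \<ge> 2"
  shows "{x. x ^ N = x} = to_ac ` {x::'f. x ^ N = x}"
proof (rule card_seteq[symmetric])
  show "to_ac ` {x::'f. x ^ N = x} \<subseteq> {x. x ^ N = x}" by (auto simp flip: to_ac_power)
  show "finite {x::'f alg_closure. x ^ N = x}" by (rule fixed_points_finite[OF assms(2)])
  show "card {x::'f alg_closure. x ^ N = x} \<le> card (to_ac ` {x::'f. x ^ N = x})"
    using fixed_points_finite(2)[OF assms(2), where 'a = "'f alg_closure"] assms(1)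
    by (simp add: card_image inj_on_def)
qed

text \<open>The identity is proved in the algebraic closure, where polynomials split, and pulled
  back: the three fixed fields there are the images of K, A and B, and \<open>\<psi>\<close> is
  transported by \<open>of_ac\<close>.\<close>

lemma hasse_davenport:
  "(\<Sum>b\<in>B. if Nm Q (Suc L) b = n then \<psi> (Tr Q (Suc L) b) else 0)
    = - (\<Sum>a\<in>A. \<Sum>y\<in>K. if Nm Q L a * y = n then \<psi> (Tr Q L a + y) else 0)"
proof -
  let ?F = "\<lambda>x::'f alg_closure. x ^ Q"
  have pow: "(?F ^^ i) x = x ^ (Q ^ i)" for i x
    by (induction i) (auto simp: power_mult[symmetric] mult.commute)
  interpret frobenius_map ?F
  proof
    show "(x + y :: 'f alg_closure) ^ Q = x ^ Q + y ^ Q" for x y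
      by (rule freshmans_dream'[where n = t]) (use p Q in auto)
    show "finite {x. (?F ^^ j) x = x}" if "j \<ge> 1" for j
      unfolding pow by (rule fixed_points_finite) (use Q_power_ge_2 that in auto)
  qed (auto simp: power_mult_distrib)
  have K': "{x. ?F x = x} = to_ac ` K" "{x. (?F ^^ L) x = x} = to_ac ` A" "{x. (?F ^^ Suc L) x = x} = to_ac ` B"
    unfolding K_def A_def B_def pow
    by (rule to_ac_fixed_points; use card_K card_A card_B Q2 Q_power_ge_2[of L] Q_power_ge_2[of "Suc L"] L in \<open>simp add: K_def A_def B_def\<close>)+
  have inj: "inj_on to_ac S" for S :: "'f set" by (auto simp: inj_on_def)
  obtain z where z: "z \<in> K" "\<psi> z \<noteq> 1" using \<psi>_nontrivial by blast
  have TN: "(\<Sum>i<j. (?F ^^ i) (to_ac a)) = to_ac (Tr Q j a)" "(\<Prod>i<j. (?F ^^ i) (to_ac a)) = to_ac (Nm Q j a)" for j a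
    by (simp_all add: pow Tr_def Nm_def to_ac_sum to_ac_prod)
  have "(\<Sum>b | (?F ^^ Suc L) b = b. if (\<Prod>i<Suc L. (?F ^^ i) b) = to_ac n then (\<psi> \<circ> of_ac) (\<Sum>i<Suc L. (?F ^^ i) b) else 0)
    = - (\<Sum>a | (?F ^^ L) a = a. \<Sum>y | ?F y = y. if (\<Prod>i<L. (?F ^^ i) a) * y = to_ac n then (\<psi> \<circ> of_ac) ((\<Sum>i<L. (?F ^^ i) a) + y) else 0)"
  proof (rule hasse_davenport_step[where z = "to_ac z"])
    show "(\<psi> \<circ> of_ac) (x + y) = (\<psi> \<circ> of_ac) x * (\<psi> \<circ> of_ac) y" if "x ^ Q = x" "y ^ Q = y" for x y
    proof -
      have "x \<in> to_ac ` K" "y \<in> to_ac ` K" using that unfolding K'(1)[symmetric] by auto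
      then obtain x' y' where "x = to_ac x'" "y = to_ac y'" "x' \<in> K" "y' \<in> K" by blast
      then show ?thesis using \<psi>_add by (simp flip: to_ac_add)
    qed
    show "to_ac z ^ Q = to_ac z" using z by (simp add: K_def flip: to_ac_power)
  qed (use z L in auto)
  then show ?thesis
    unfolding K' TN sum.reindex[OF inj] comp_def
    by (simp only: of_ac_to_ac to_ac_eq_iff TN flip: to_ac_add to_ac_mult)
qed

end

text \<open>Translation by z permutes S and multiplies the sum by \<open>\<chi> z\<close>, which is
  not 1.\<close>

lemma additive_character_sum_eq_0:
  fixes \<chi> :: "'a::ab_group_add \<Rightarrow> complex"
  assumes add: "\<And>x y. x \<in> S \<Longrightarrow> y \<in> S \<Longrightarrow> x + y \<in> S" and neg: "\<And>x. x \<in> S \<Longrightarrow> - x \<in> S"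
    and \<chi>: "\<And>x y. x \<in> S \<Longrightarrow> y \<in> S \<Longrightarrow> \<chi> (x + y) = \<chi> x * \<chi> y"
    and z: "z \<in> S" "\<chi> z \<noteq> 1"
  shows "(\<Sum>x\<in>S. \<chi> x) = 0"
proof -
  have "(\<Sum>x\<in>S. \<chi> x) = (\<Sum>x\<in>S. \<chi> z * \<chi> x)"
  proof (rule sum.reindex_bij_witness[of _ "\<lambda>x. z + x" "\<lambda>x. - z + x"])
    fix x assume x: "x \<in> S"
    show z': "- z + x \<in> S" "z + x \<in> S"
      using add[OF neg[OF z(1)] x] add[OF z(1) x] by simp_all
    have "\<chi> (z + (- z + x)) = \<chi> z * \<chi> (- z + x)" using z(1) z'(1) by (rule \<chi>)
    then show "\<chi> z * \<chi> (- z + x) = \<chi> x" by simp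
  qed auto
  also have "\<dots> = \<chi> z * (\<Sum>x\<in>S. \<chi> x)" by (simp add: sum_distrib_left)
  finally have "(\<Sum>x\<in>S. \<chi> x) = \<chi> z * (\<Sum>x\<in>S. \<chi> x)" .
  then show ?thesis using z(2) by simp
qed

section \<open>Lifted additive characters and fibres of the norm\<close>

context field_tower
begin

text \<open>A uniform name for K, A and B, at n = 1, L and L + 1. For other n the set may have fewer
  than \<open>Q ^ n\<close> elements, hence the explicit cardinality assumptions below.\<close>

definition Fn :: "nat \<Rightarrow> 'f set" where
  "Fn n = {x. x ^ (Q ^ n) = x}"

text \<open>This is (Q^n - 1) / (Q - 1), both the exponent of the norm and the size of its fibres
  over nonzero elements of K.\<close>

definition fibre_size :: "nat \<Rightarrow> nat" where
  "fibre_size n = (\<Sum>i<n. Q ^ i)"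

definition \<chi> :: "nat \<Rightarrow> 'f \<Rightarrow> complex" where
  "\<chi> n x = \<psi> (Tr Q n x)"

abbreviation T :: "nat \<Rightarrow> 'f \<Rightarrow> 'f" where "T \<equiv> Tr Q"
abbreviation N :: "nat \<Rightarrow> 'f \<Rightarrow> 'f" where "N \<equiv> Nm Q"

lemma K_eq: "K = Fn 1" and A_eq: "A = Fn L" and B_eq: "B = Fn (Suc L)"
  by (simp_all add: Fn_def K_def A_def B_def)

lemma Fn_add: "x \<in> Fn n \<Longrightarrow> y \<in> Fn n \<Longrightarrow> x + y \<in> Fn n"
  by (simp add: Fn_def frob_add)

lemma Fn_mult: "x \<in> Fn n \<Longrightarrow> y \<in> Fn n \<Longrightarrow> x * y \<in> Fn n"
  by (simp add: Fn_def power_mult_distrib)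

lemma Fn_divide: "x \<in> Fn n \<Longrightarrow> y \<in> Fn n \<Longrightarrow> x / y \<in> Fn n"
  by (simp add: Fn_def power_divide)

lemma Fn_0 [simp]: "0 \<in> Fn n" and Fn_1 [simp]: "1 \<in> Fn n"
  using Q2 by (auto simp: Fn_def power_0_left)

lemma Fn_uminus: "x \<in> Fn n \<Longrightarrow> - x \<in> Fn n"
  using frob_add[of x "- x" n] Q2 by (simp add: Fn_def power_0_left eq_neg_iff_add_eq_0 add.commute)

lemma K_subset_Fn: "K \<subseteq> Fn n"
proof
  fix x assume x: "x \<in> K"
  have "x ^ (Q ^ n) = x" by (induction n) (use x in \<open>auto simp: K_def power_mult\<close>)
  then show "x \<in> Fn n" by (simp add: Fn_def)
qed

lemma T_add: "T n (x + y) = T n x + T n y"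
  by (simp add: Tr_def frob_add sum.distrib)

lemma T_scale: "c \<in> K \<Longrightarrow> T n (c * x) = c * T n x"
  using K_subset_Fn unfolding Tr_def sum_distrib_left
  by (intro sum.cong) (auto simp: power_mult_distrib Fn_def)

lemma T_0 [simp]: "T n 0 = 0"
  using T_add[of n 0 0] by (metis add_cancel_right_right add_0)

text \<open>The Frobenius map shifts the conjugates by one place, and \<open>x ^ (Q ^ n) = x\<close>
  closes the cycle.\<close>

lemma T_in_K:
  assumes "x \<in> Fn n"
  shows "T n x \<in> K"
proof -
  have "T n x ^ Q = (\<Sum>i<n. x ^ Q ^ Suc i)"
    using frob_sum[of "\<lambda>i. x ^ Q ^ i" "{..<n}" 1] by (simp add: Tr_def power_mult[symmetric] mult.commute)
  also have "\<dots> = T n x"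
    using sum.lessThan_Suc_shift[of "\<lambda>i. x ^ Q ^ i" n] assms by (simp add: Tr_def Fn_def)
  finally show ?thesis by (simp add: K_def)
qed

text \<open>The same cyclic shift for products; x = 0 is separate because closing the cycle cancels
  a factor.\<close>

lemma N_in_K:
  assumes "x \<in> Fn n"
  shows "N n x \<in> K"
proof (cases "x = 0")
  case True
  then show ?thesis using Q2 by (cases n) (auto simp: Nm_def K_def prod.lessThan_Suc_shift power_0_left)
next
  case False
  have "N n x ^ Q = (\<Prod>i<n. x ^ Q ^ Suc i)"
    by (simp add: Nm_def prod_power_distrib power_mult[symmetric] mult.commute)
  also have "\<dots> = N n x"
    using prod.lessThan_Suc_shift[of "\<lambda>i. x ^ Q ^ i" n] assms False by (simp add: Nm_def Fn_def)
  finally show ?thesis by (simp add: K_def)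
qed

lemma N_divide: "N n (x / y) = N n x / N n y"
  by (simp add: Nm_def power_divide prod_dividef)

lemma N_minus_1_squared: "N n (- 1) * N n (- 1) = 1"
  by (simp flip: Nm_mult) (simp add: Nm_def)

text \<open>The trace is a nonzero polynomial of degree at most \<open>Q ^ (n - 1)\<close>, so it
  cannot vanish at all \<open>Q ^ n\<close> points.\<close>

lemma ex_T_nonzero:
  assumes n: "n \<ge> 1" and card: "card (Fn n) = Q ^ n"
  shows "\<exists>a\<in>Fn n. T n a \<noteq> 0"
proof (rule ccontr)
  assume "\<not> ?thesis"
  then have zero: "T n x = 0" if "x \<in> Fn n" for x using that by blast
  obtain k where k: "n = Suc k" using n by (cases n) auto
  let ?f = "\<Sum>i<n. Polynomial.monom 1 (Q ^ i) :: 'f poly"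
  have Qi: "Q ^ i < Q ^ k" if "i < k" for i
    using that Q2 by (intro power_strict_increasing) auto
  have "Polynomial.coeff ?f (Q ^ k) = (\<Sum>i<n. if i = k then 1 else 0)"
    unfolding coeff_sum using Q2 by (intro sum.cong) (auto simp: power_inject_exp)
  then have "Polynomial.coeff ?f (Q ^ k) = 1" by (simp add: k)
  then have nz: "?f \<noteq> 0" by (metis coeff_0 zero_neq_one)
  have "Polynomial.degree ?f \<le> Q ^ k"
  proof (rule degree_sum_le)
    fix i assume "i \<in> {..<n}"
    then have "Q ^ i \<le> Q ^ k" using Q2 k by (intro power_increasing) auto
    then show "Polynomial.degree (Polynomial.monom 1 (Q ^ i) :: 'f poly) \<le> Q ^ k"
      using degree_monom_le le_trans by blast
  qed simp
  moreover have "poly ?f x = 0" if "x \<in> Fn n" for x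
    using zero[OF that] by (simp add: poly_sum poly_monom Tr_def)
  ultimately have "card (Fn n) \<le> Q ^ k" using card_roots_le(2)[OF nz, of "Fn n"] le_trans by blast
  then show False using card Q2 k by simp
qed

lemma \<chi>_add: "x \<in> Fn n \<Longrightarrow> y \<in> Fn n \<Longrightarrow> \<chi> n (x + y) = \<chi> n x * \<chi> n y"
  by (simp add: \<chi>_def T_add \<psi>_add T_in_K)

lemma \<chi>_0 [simp]: "\<chi> n 0 = 1"
  by (simp add: \<chi>_def \<psi>_0)

text \<open>An element of nonzero trace can be scaled by K so that its trace is any prescribed
  element, in particular one where \<open>\<psi>\<close> is not 1.\<close>

lemma \<chi>_nontrivial:
  assumes n: "n \<ge> 1" and card: "card (Fn n) = Q ^ n"
  shows "\<exists>a\<in>Fn n. \<chi> n a \<noteq> 1"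
proof -
  obtain a where a: "a \<in> Fn n" "T n a \<noteq> 0" using ex_T_nonzero[OF assms] by blast
  obtain z where z: "z \<in> K" "\<psi> z \<noteq> 1" using \<psi>_nontrivial by blast
  have c: "z / T n a \<in> K" using z T_in_K[OF a(1)] Fn_divide K_eq by auto
  then have "T n (z / T n a * a) = z" using a(2) T_scale[OF c, of n a] by simp
  then have "\<chi> n (z / T n a * a) \<noteq> 1" using z by (simp add: \<chi>_def)
  moreover have "z / T n a * a \<in> Fn n" using c K_subset_Fn a(1) by (intro Fn_mult) auto
  ultimately show ?thesis by blast
qed

text \<open>Orthogonality: for u nonzero, dividing a witness of nontriviality by u shows that the
  twisted character is nontrivial as well.\<close>

lemma \<chi>_sum:
  assumes n: "n \<ge> 1" and card: "card (Fn n) = Q ^ n" and u: "u \<in> Fn n"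
  shows "(\<Sum>a\<in>Fn n. \<chi> n (u * a)) = (if u = 0 then of_nat (Q ^ n) else 0)"
proof (cases "u = 0")
  case True
  then show ?thesis using card by simp
next
  case False
  obtain a where a: "a \<in> Fn n" "\<chi> n a \<noteq> 1" using \<chi>_nontrivial[OF n card] by blast
  have "(\<Sum>a\<in>Fn n. \<chi> n (u * a)) = 0"
  proof (rule additive_character_sum_eq_0[where z = "a / u"])
    show "\<chi> n (u * (x + y)) = \<chi> n (u * x) * \<chi> n (u * y)" if "x \<in> Fn n" "y \<in> Fn n" for x y
      using that u by (simp add: distrib_left \<chi>_add Fn_mult)
  qed (use a u False Fn_add Fn_uminus Fn_divide in auto)
  then show ?thesis using False by simp
qed

lemma \<chi>_sum_nonzero:
  assumes n: "n \<ge> 1" and card: "card (Fn n) = Q ^ n" and u: "u \<in> Fn n"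
  shows "(\<Sum>a\<in>Fn n - {0}. \<chi> n (u * a)) = (if u = 0 then of_nat (Q ^ n) else 0) - 1"
proof -
  have "finite (Fn n)" using card Q2 by (auto intro!: card_ge_0_finite)
  then show ?thesis using \<chi>_sum[OF assms] by (simp add: sum_diff1)
qed

lemma fibre_size_mult: "(Q - 1) * fibre_size n = Q ^ n - 1"
  unfolding fibre_size_def by (rule geometric_sum_mult)

text \<open>No fibre of the norm has more than \<open>fibre_size n\<close> elements, and this is the average.\<close>

lemma card_fibre:
  assumes n: "n \<ge> 1" and card: "card (Fn n) = Q ^ n" and c: "c \<in> K - {0}"
  shows "card {x \<in> Fn n. N n x = c} = fibre_size n"
proof -
  let ?f = "\<lambda>c. card {x \<in> Fn n. N n x = c}"
  have fin: "finite (Fn n)" using card Q2 by (auto intro!: card_ge_0_finite)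
  have pos: "fibre_size n \<ge> 1"
    using n Q2 by (cases n) (auto simp: fibre_size_def intro!: trans_le_add2)
  have finp: "finite {x::'f. x ^ fibre_size n = c}" for c
  proof -
    have "{x::'f. x ^ fibre_size n = c} \<subseteq> {x. poly (Polynomial.monom 1 (fibre_size n) - [:c:]) x = 0}"
      by (auto simp: poly_monom)
    moreover have "Polynomial.coeff (Polynomial.monom 1 (fibre_size n) - [:c:]) (fibre_size n) = 1"
      using pos by (auto simp: coeff_pCons split: nat.splits)
    ultimately show ?thesis
      by (metis coeff_0 finite_subset poly_roots_finite zero_neq_one)
  qed
  have le: "?f c \<le> fibre_size n" for c
  proof -
    have "?f c \<le> card {x::'f. x ^ fibre_size n = c}"
      using finp by (intro card_mono) (auto simp: Nm_eq_power fibre_size_def)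
    also have "\<dots> \<le> fibre_size n" using pos by (rule card_power_eq_le)
    finally show ?thesis .
  qed
  have "Fn n - {0} = (\<Union>c\<in>K - {0}. {x \<in> Fn n. N n x = c})"
    using N_in_K n by (auto simp: Nm_eq_0_iff)
  moreover have "card (\<Union>c\<in>K - {0}. {x \<in> Fn n. N n x = c}) = (\<Sum>c\<in>K - {0}. ?f c)"
    using fin finite_K by (intro card_UN_disjoint) auto
  ultimately have "card (Fn n - {0}) = (\<Sum>c\<in>K - {0}. ?f c)" by simp
  moreover have "card (Fn n - {0}) = (Q - 1) * fibre_size n"
    using card fin by (simp add: fibre_size_mult del: One_nat_def)
  moreover have "(\<Sum>c\<in>K - {0}. fibre_size n) = (Q - 1) * fibre_size n"
    using card_K finite_K K_eq by simp
  ultimately have "(\<Sum>c\<in>K - {0}. ?f c) = (\<Sum>c\<in>K - {0}. fibre_size n)" by simp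
  then show ?thesis
    using sum_mono_inv[of ?f "K - {0}" "\<lambda>_. fibre_size n"] le c finite_K by simp
qed

lemma card_Fn_L: "card (Fn L) = Q ^ L" and card_Fn_Suc_L: "card (Fn (Suc L)) = Q ^ Suc L"
  using card_A card_B by (simp_all add: A_eq B_eq)

lemma finite_Fn_L: "finite (Fn L)" and finite_Fn_Suc_L: "finite (Fn (Suc L))"
  using finite_A finite_B by (simp_all add: A_eq B_eq)

lemma \<psi>_sum_nonzero: "(\<Sum>z\<in>K - {0}. \<psi> z) = - 1"
proof -
  have "\<chi> 1 x = \<psi> x" for x by (simp add: \<chi>_def Tr_def)
  then show ?thesis using \<chi>_sum_nonzero[of 1 1] card_K by (simp add: K_eq)
qed

text \<open>Substituting \<open>a' = a c\<close> after one Davenport--Hasse step leaves complete character sums over \<open>a\<close>,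
  which are concentrated at \<open>c = - 1\<close>.\<close>

lemma norm_twisted_sum:
  assumes y: "y \<in> K - {0}"
  shows "(\<Sum>a\<in>Fn L - {0}. \<Sum>b\<in>Fn (Suc L). if N (Suc L) b = y * N L a then \<chi> L a * \<chi> (Suc L) b else 0)
    = - of_nat (Q ^ L) * \<psi> (N L (- 1) * y) - of_nat (fibre_size L)"
proof -
  let ?A = "Fn L - {0}"
  have DH: "(\<Sum>b\<in>Fn (Suc L). if N (Suc L) b = n then \<chi> (Suc L) b else 0)
      = - (\<Sum>c\<in>Fn L. \<Sum>z\<in>K. if N L c * z = n then \<chi> L c * \<psi> z else 0)" for n
  proof -
    have "(if N L c * z = n then \<psi> (T L c + z) else 0) = (if N L c * z = n then \<chi> L c * \<psi> z else 0)"
      if "c \<in> Fn L" "z \<in> K" for c z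
      using that \<psi>_add[OF T_in_K[OF that(1)] that(2)] by (simp add: \<chi>_def)
    then show ?thesis using hasse_davenport[of n, folded \<chi>_def] by (simp add: A_eq B_eq)
  qed
  \<comment> \<open>Multiplicativity of the norm cancels \<open>N L a\<close> from the condition,
    leaving a only inside the character.\<close>
  have shift: "(\<Sum>a'\<in>Fn L. \<Sum>z\<in>K. if N L a' * z = y * N L a then \<chi> L a' * \<psi> z else 0)
      = (\<Sum>c\<in>Fn L. \<Sum>z\<in>K. if N L c * z = y then \<chi> L (a * c) * \<psi> z else 0)" if a: "a \<in> ?A" for a
  proof (rule sum.reindex_bij_witness[of _ "\<lambda>c. a * c" "\<lambda>a'. a' / a"])
    fix c assume c: "c \<in> Fn L"
    have "N L a \<noteq> 0" using a L by (simp add: Nm_eq_0_iff)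
    then have "N L (c / a) * z = y \<longleftrightarrow> N L c * z = y * N L a" for z
      by (auto simp: N_divide field_simps)
    then show "(\<Sum>z\<in>K. if N L (c / a) * z = y then \<chi> L (a * (c / a)) * \<psi> z else 0)
        = (\<Sum>z\<in>K. if N L c * z = y * N L a then \<chi> L c * \<psi> z else 0)"
      using a by (intro sum.cong) auto
  qed (use a Fn_mult Fn_divide in auto)
  \<comment> \<open>The two characters merge into one at (1 + c) a; subtracting 1 accounts for the
    missing term a = 0.\<close>
  have inner: "(\<Sum>a\<in>?A. \<chi> L a * \<chi> L (a * c)) = (if c = - 1 then of_nat (Q ^ L) else 0) - 1" if c: "c \<in> Fn L" for c
  proof -
    have "\<chi> L a * \<chi> L (a * c) = \<chi> L ((1 + c) * a)" if "a \<in> ?A" for a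
      using that c by (simp add: ring_distribs \<chi>_add Fn_mult mult.commute)
    then have "(\<Sum>a\<in>?A. \<chi> L a * \<chi> L (a * c)) = (\<Sum>a\<in>?A. \<chi> L ((1 + c) * a))" by simp
    also have "\<dots> = (if 1 + c = 0 then of_nat (Q ^ L) else 0) - 1"
      using c L by (intro \<chi>_sum_nonzero card_Fn_L Fn_add) auto
    also have "1 + c = 0 \<longleftrightarrow> c = - 1" by (auto simp: add_eq_0_iff)
    finally show ?thesis .
  qed
  \<comment> \<open>The norm condition now involves c and z alone, so this weight comes out of the
    sum over a.\<close>
  define w where "w c = (\<Sum>z\<in>K. if N L c * z = y then \<psi> z else 0)" for c
  have "(\<Sum>a\<in>?A. \<Sum>b\<in>Fn (Suc L). if N (Suc L) b = y * N L a then \<chi> L a * \<chi> (Suc L) b else 0)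
      = (\<Sum>a\<in>?A. \<chi> L a * (\<Sum>b\<in>Fn (Suc L). if N (Suc L) b = y * N L a then \<chi> (Suc L) b else 0))"
    by (simp add: sum_distrib_left if_distrib[where f = "(*) _"] cong: if_cong)
  also have "\<dots> = (\<Sum>a\<in>?A. - (\<chi> L a * (\<Sum>c\<in>Fn L. \<Sum>z\<in>K. if N L c * z = y then \<chi> L (a * c) * \<psi> z else 0)))"
    unfolding DH using shift by (intro sum.cong) simp_all
  also have "\<dots> = - (\<Sum>a\<in>?A. \<Sum>c\<in>Fn L. w c * (\<chi> L a * \<chi> L (a * c)))"
    unfolding w_def sum_distrib_left sum_distrib_right sum_negf
    by (intro arg_cong[where f = uminus] sum.cong) auto
  also have "(\<Sum>a\<in>?A. \<Sum>c\<in>Fn L. w c * (\<chi> L a * \<chi> L (a * c))) = (\<Sum>c\<in>Fn L. w c * (\<Sum>a\<in>?A. \<chi> L a * \<chi> L (a * c)))"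
    by (subst sum.swap) (simp add: sum_distrib_left)
  also have "\<dots> = (\<Sum>c\<in>Fn L. (if c = - 1 then w c * of_nat (Q ^ L) else 0) - w c)"
    by (intro sum.cong refl, subst inner) (auto simp: right_diff_distrib)
  also have "\<dots> = w (- 1) * of_nat (Q ^ L) - (\<Sum>c\<in>Fn L. w c)"
    unfolding sum_subtractf using finite_Fn_L Fn_uminus[OF Fn_1] by simp
  \<comment> \<open>\<open>N L (- 1)\<close> is its own inverse, so exactly one z meets the norm
    condition at c = - 1.\<close>
  also have "w (- 1) = \<psi> (N L (- 1) * y)"
  proof -
    have eq: "N L (- 1) * z = y \<longleftrightarrow> z = N L (- 1) * y" for z
      using N_minus_1_squared[of L] by (metis mult.assoc mult_1)
    moreover have "N L (- 1) * y \<in> K"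
      using y N_in_K[OF Fn_uminus[OF Fn_1]] Fn_mult[of _ 1] K_eq by auto
    ultimately show ?thesis using finite_K by (simp add: w_def)
  qed
  \<comment> \<open>Summing over c first gives a full norm fibre for each nonzero z, while z = 0 is
    excluded by y nonzero. What remains is the sum of \<open>\<psi>\<close> over the nonzero
    elements of K, which is - 1.\<close>
  also have "(\<Sum>c\<in>Fn L. w c) = - of_nat (fibre_size L)"
  proof -
    have "(\<Sum>c\<in>Fn L. w c) = (\<Sum>z\<in>K. \<Sum>c\<in>Fn L. if N L c * z = y then \<psi> z else 0)"
      unfolding w_def by (rule sum.swap)
    also have "\<dots> = (\<Sum>z\<in>K - {0}. \<Sum>c\<in>Fn L. if N L c * z = y then \<psi> z else 0)"
      using y finite_K by (intro sum.mono_neutral_right) auto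
    also have "\<dots> = (\<Sum>z\<in>K - {0}. of_nat (fibre_size L) * \<psi> z)"
    proof (rule sum.cong)
      fix z assume z: "z \<in> K - {0}"
      have "(\<Sum>c\<in>Fn L. if N L c * z = y then \<psi> z else 0) = (\<Sum>c\<in>{c \<in> Fn L. N L c = y / z}. \<psi> z)"
        using z finite_Fn_L by (simp add: sum.inter_filter[symmetric] eq_divide_eq)
      also have "\<dots> = of_nat (fibre_size L) * \<psi> z"
        using card_fibre[OF L card_Fn_L, of "y / z"] y z Fn_divide[of _ 1] K_eq by simp
      finally show "(\<Sum>c\<in>Fn L. if N L c * z = y then \<psi> z else 0) = of_nat (fibre_size L) * \<psi> z" .
    qed simp
    also have "\<dots> = - of_nat (fibre_size L)" using \<psi>_sum_nonzero by (simp flip: sum_distrib_left)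
    finally show ?thesis .
  qed
  finally show ?thesis by (simp add: mult.commute)
qed

end

section \<open>Character values of the norm quotient set\<close>

text \<open>The character sums see R as an additive subgroup of K; scalar multiplication enters
  later, when its nonzero part is matched with cyclotomic classes.\<close>

locale norm_quotient_set = field_tower +
  fixes R :: "'a set"
  assumes R_sub: "R \<subseteq> K" and R_0: "0 \<in> R"
    and R_add: "\<And>x y. x \<in> R \<Longrightarrow> y \<in> R \<Longrightarrow> x + y \<in> R" and R_uminus: "\<And>x. x \<in> R \<Longrightarrow> - x \<in> R"
begin

text \<open>Since 0 lies in R, the condition covers b = 0 too, so the pairs (a, 0) need no separate
  clause.\<close>

definition quotient_set :: "('a \<times> 'a) set" where
  "quotient_set = {(a, b). a \<in> Fn L \<and> b \<in> Fn (Suc L) \<and> a \<noteq> 0 \<and> N (Suc L) b / N L a \<in> R}"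

definition \<rho> :: nat where "\<rho> = card (R - {0})"

definition pair_char :: "'a \<Rightarrow> 'a \<Rightarrow> 'a \<Rightarrow> 'a \<Rightarrow> complex" where
  "pair_char u v a b = \<chi> L (u * a) * \<chi> (Suc L) (v * b)"

text \<open>The two values at nontrivial characters. Their difference
  \<open>\<theta>\<^sub>1 - \<theta>\<^sub>2\<close> is \<open>Q ^ L\<close> times the order of
  R.\<close>

definition \<theta>\<^sub>1 :: real where "\<theta>\<^sub>1 = real (Q ^ L) - 1 - real \<rho> * real (fibre_size L)"
definition \<theta>\<^sub>2 :: real where "\<theta>\<^sub>2 = - 1 - real \<rho> * real (fibre_size (Suc L))"

lemma finite_R: "finite R"
  using R_sub finite_K by (rule finite_subset)

lemma card_R: "card R = Suc \<rho>"
  unfolding \<rho>_def using finite_R R_0 by (rule card.remove)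

lemma fibre_size_Suc: "fibre_size (Suc n) = Q ^ n + fibre_size n"
  by (simp add: fibre_size_def)

text \<open>The pairs are sliced by the value y of the norm quotient; the slice y = 0 consists of
  the pairs with b = 0.\<close>

lemma sum_quotient_set:
  fixes f :: "'a \<Rightarrow> 'a \<Rightarrow> complex"
  shows "(\<Sum>(a, b)\<in>quotient_set. f a b) = (\<Sum>a\<in>Fn L - {0}. f a 0)
    + (\<Sum>y\<in>R - {0}. \<Sum>a\<in>Fn L - {0}. \<Sum>b\<in>Fn (Suc L). if N (Suc L) b = y * N L a then f a b else 0)"
proof -
  have "quotient_set = Sigma (Fn L - {0}) (\<lambda>a. {b \<in> Fn (Suc L). N (Suc L) b / N L a \<in> R})"
    by (auto simp: quotient_set_def)
  then have "(\<Sum>(a, b)\<in>quotient_set. f a b) = (\<Sum>a\<in>Fn L - {0}. \<Sum>b\<in>{b \<in> Fn (Suc L). N (Suc L) b / N L a \<in> R}. f a b)"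
    using finite_Fn_L finite_Fn_Suc_L by (simp add: sum.Sigma)
  also have "\<dots> = (\<Sum>a\<in>Fn L - {0}. \<Sum>b\<in>Fn (Suc L). \<Sum>y\<in>R. if N (Suc L) b = y * N L a then f a b else 0)"
  proof (rule sum.cong)
    fix a assume a: "a \<in> Fn L - {0}"
    then have Na: "N L a \<noteq> 0" using L by (simp add: Nm_eq_0_iff)
    have "(\<Sum>b\<in>{b \<in> Fn (Suc L). N (Suc L) b / N L a \<in> R}. f a b)
        = (\<Sum>b\<in>Fn (Suc L). if N (Suc L) b / N L a \<in> R then f a b else 0)"
      by (rule sum.inter_filter[OF finite_Fn_Suc_L])
    also have "\<dots> = (\<Sum>b\<in>Fn (Suc L). \<Sum>y\<in>R. if N (Suc L) b = y * N L a then f a b else 0)"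
    proof (rule sum.cong)
      fix b
      have "N (Suc L) b = y * N L a \<longleftrightarrow> y = N (Suc L) b / N L a" for y
        using Na by (auto simp: field_simps)
      then show "(if N (Suc L) b / N L a \<in> R then f a b else 0) = (\<Sum>y\<in>R. if N (Suc L) b = y * N L a then f a b else 0)"
        using finite_R by simp
    qed simp
    finally show "(\<Sum>b\<in>{b \<in> Fn (Suc L). N (Suc L) b / N L a \<in> R}. f a b)
      = (\<Sum>b\<in>Fn (Suc L). \<Sum>y\<in>R. if N (Suc L) b = y * N L a then f a b else 0)" .
  qed simp
  also have "\<dots> = (\<Sum>a\<in>Fn L - {0}. \<Sum>y\<in>R. \<Sum>b\<in>Fn (Suc L). if N (Suc L) b = y * N L a then f a b else 0)"
    by (intro sum.cong refl sum.swap)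
  also have "\<dots> = (\<Sum>y\<in>R. \<Sum>a\<in>Fn L - {0}. \<Sum>b\<in>Fn (Suc L). if N (Suc L) b = y * N L a then f a b else 0)"
    by (rule sum.swap)
  also have "\<dots> = (\<Sum>a\<in>Fn L - {0}. \<Sum>b\<in>Fn (Suc L). if N (Suc L) b = 0 then f a b else 0)
    + (\<Sum>y\<in>R - {0}. \<Sum>a\<in>Fn L - {0}. \<Sum>b\<in>Fn (Suc L). if N (Suc L) b = y * N L a then f a b else 0)"
    by (subst sum.remove[OF finite_R R_0]) simp
  also have "(\<Sum>a\<in>Fn L - {0}. \<Sum>b\<in>Fn (Suc L). if N (Suc L) b = 0 then f a b else 0) = (\<Sum>a\<in>Fn L - {0}. f a 0)"
    using finite_Fn_Suc_L by (simp add: Nm_eq_0_iff)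
  finally show ?thesis .
qed

lemma finite_quotient_set: "finite quotient_set"
  by (rule finite_subset[of _ "Fn L \<times> Fn (Suc L)"]) (auto simp: quotient_set_def finite_Fn_L finite_Fn_Suc_L)

lemma fibre_sum_B:
  fixes c :: complex
  assumes "y \<in> R - {0}" "a \<in> Fn L - {0}"
  shows "(\<Sum>b\<in>Fn (Suc L). if N (Suc L) b = y * N L a then c else 0) = of_nat (fibre_size (Suc L)) * c"
proof -
  have "y * N L a \<in> K - {0}"
    using assms R_sub N_in_K[of a L] L Fn_mult[of y 1 "N L a"] K_eq by (auto simp: Nm_eq_0_iff)
  then have "card {b \<in> Fn (Suc L). N (Suc L) b = y * N L a} = fibre_size (Suc L)"
    by (intro card_fibre card_Fn_Suc_L) auto
  then show ?thesis using finite_Fn_Suc_L by (simp flip: sum.inter_filter)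
qed

text \<open>The slicing applied to the constant 1: each nonzero a has one b over y = 0 and a full
  norm fibre over each nonzero y in R.\<close>

lemma card_quotient_set: "real (card quotient_set) = (real (Q ^ L) - 1) * (1 + real \<rho> * real (fibre_size (Suc L)))"
proof -
  have "of_nat (card quotient_set) = (\<Sum>(a, b)\<in>quotient_set. 1 :: complex)" by simp
  also have "\<dots> = of_nat (card (Fn L - {0})) * (1 + of_nat \<rho> * of_nat (fibre_size (Suc L)))"
    unfolding sum_quotient_set by (simp add: fibre_sum_B \<rho>_def ring_distribs)
  also have "card (Fn L - {0}) = Q ^ L - 1" using card_Fn_L finite_Fn_L by simp
  also have "of_nat (Q ^ L - 1) * (1 + of_nat \<rho> * of_nat (fibre_size (Suc L)))
      = (of_nat ((Q ^ L - 1) * (1 + \<rho> * fibre_size (Suc L))) :: complex)"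
    by (simp only: of_nat_1 of_nat_add of_nat_mult)
  finally have "card quotient_set = (Q ^ L - 1) * (1 + \<rho> * fibre_size (Suc L))"
    by (simp only: of_nat_eq_iff)
  moreover have "real (Q ^ L - 1) = real (Q ^ L) - 1" using Q_power_ge_2[OF L] by (simp add: of_nat_diff)
  ultimately show ?thesis by (simp only: of_nat_mult of_nat_add of_nat_1)
qed

text \<open>The character ignores b, so each nonzero slice contributes a fibre size times the sum
  over a, which is - 1.\<close>

lemma char_sum_u0:
  assumes u: "u \<in> Fn L" "u \<noteq> 0"
  shows "(\<Sum>(a, b)\<in>quotient_set. pair_char u 0 a b) = of_real \<theta>\<^sub>2"
proof -
  have s: "(\<Sum>a\<in>Fn L - {0}. \<chi> L (u * a)) = - 1"
    using \<chi>_sum_nonzero[OF L card_Fn_L u(1)] u(2) by simp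
  have "(\<Sum>(a, b)\<in>quotient_set. pair_char u 0 a b) = (\<Sum>a\<in>Fn L - {0}. \<chi> L (u * a))
      + (\<Sum>y\<in>R - {0}. \<Sum>a\<in>Fn L - {0}. of_nat (fibre_size (Suc L)) * \<chi> L (u * a))"
    unfolding sum_quotient_set by (simp add: pair_char_def fibre_sum_B cong: if_cong)
  also have "\<dots> = of_real \<theta>\<^sub>2"
    by (simp add: s \<theta>\<^sub>2_def \<rho>_def flip: sum_distrib_left)
  finally show ?thesis .
qed

text \<open>Here a is summed first: for nonzero y and b it runs over a norm fibre, and b = 0
  contributes nothing. The remaining sum over nonzero b is - 1.\<close>

lemma char_sum_0v:
  assumes v: "v \<in> Fn (Suc L)" "v \<noteq> 0"
  shows "(\<Sum>(a, b)\<in>quotient_set. pair_char 0 v a b) = of_real \<theta>\<^sub>1"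
proof -
  have s: "(\<Sum>b\<in>Fn (Suc L) - {0}. \<chi> (Suc L) (v * b)) = - 1"
    using \<chi>_sum_nonzero[OF _ card_Fn_Suc_L v(1)] v(2) by simp
  have "(\<Sum>a\<in>Fn L - {0}. \<Sum>b\<in>Fn (Suc L). if N (Suc L) b = y * N L a then pair_char 0 v a b else 0) = - of_nat (fibre_size L)"
    if y: "y \<in> R - {0}" for y
  proof -
    have "(\<Sum>a\<in>Fn L - {0}. \<Sum>b\<in>Fn (Suc L). if N (Suc L) b = y * N L a then pair_char 0 v a b else 0)
       = (\<Sum>b\<in>Fn (Suc L). \<Sum>a\<in>Fn L - {0}. if N (Suc L) b = y * N L a then \<chi> (Suc L) (v * b) else 0)"
      by (subst sum.swap) (simp add: pair_char_def cong: if_cong)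
    also have "\<dots> = (\<Sum>b\<in>Fn (Suc L) - {0}. \<Sum>a\<in>Fn L - {0}. if N (Suc L) b = y * N L a then \<chi> (Suc L) (v * b) else 0)"
    proof (rule sum.mono_neutral_right)
      have "N (Suc L) 0 \<noteq> y * N L a" if "a \<in> Fn L - {0}" for a
      proof -
        have "y * N L a \<noteq> 0" using that y L by (simp add: Nm_eq_0_iff)
        moreover have "N (Suc L) 0 = 0" by (simp add: Nm_eq_0_iff)
        ultimately show ?thesis by metis
      qed
      then show "\<forall>b\<in>Fn (Suc L) - (Fn (Suc L) - {0}). (\<Sum>a\<in>Fn L - {0}. if N (Suc L) b = y * N L a then \<chi> (Suc L) (v * b) else 0) = 0"
        by (auto intro!: sum.neutral)
    qed (use finite_Fn_Suc_L in auto)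
    also have "\<dots> = (\<Sum>b\<in>Fn (Suc L) - {0}. of_nat (fibre_size L) * \<chi> (Suc L) (v * b))"
    proof (rule sum.cong)
      fix b assume b: "b \<in> Fn (Suc L) - {0}"
      have Nb: "N (Suc L) b / y \<in> K - {0}"
        using b y R_sub N_in_K[of b "Suc L"] Fn_divide[of "N (Suc L) b" 1 y] K_eq by (auto simp: Nm_eq_0_iff)
      have "{a \<in> Fn L - {0}. N (Suc L) b = y * N L a} = {a \<in> Fn L. N L a = N (Suc L) b / y}"
      proof -
        have "N L a = N (Suc L) b / y \<longleftrightarrow> N (Suc L) b = y * N L a" for a
          using y by (auto simp: field_simps)
        moreover have "N L 0 \<noteq> N (Suc L) b / y" using Nb L Nm_eq_0_iff[of L Q "0::'a"] by auto
        ultimately show ?thesis by auto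
      qed
      then have "card {a \<in> Fn L - {0}. N (Suc L) b = y * N L a} = fibre_size L"
        using card_fibre[OF L card_Fn_L Nb] by simp
      then show "(\<Sum>a\<in>Fn L - {0}. if N (Suc L) b = y * N L a then \<chi> (Suc L) (v * b) else 0) = of_nat (fibre_size L) * \<chi> (Suc L) (v * b)"
        using finite_Fn_L by (simp flip: sum.inter_filter)
    qed simp
    also have "\<dots> = - of_nat (fibre_size L)" by (simp add: s flip: sum_distrib_left)
    finally show ?thesis .
  qed
  then have "(\<Sum>(a, b)\<in>quotient_set. pair_char 0 v a b) = of_nat (card (Fn L - {0})) - of_nat \<rho> * of_nat (fibre_size L)"
    unfolding sum_quotient_set by (simp add: pair_char_def \<rho>_def)
  also have "card (Fn L - {0}) = Q ^ L - 1" using card_Fn_L finite_Fn_L by simp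
  finally show ?thesis using Q_power_ge_2[OF L] by (simp add: \<theta>\<^sub>1_def of_nat_diff)
qed

text \<open>After \<open>norm_twisted_sum\<close> only the sum of \<open>\<psi> (c * y)\<close> over
  y in R is left. It is the order of R if \<open>\<psi>\<close> is trivial on c R, giving
  \<open>\<theta>\<^sub>2\<close>, and 0 otherwise, giving \<open>\<theta>\<^sub>1\<close>.\<close>

lemma char_sum_uv:
  assumes u: "u \<in> Fn L" "u \<noteq> 0" and v: "v \<in> Fn (Suc L)" "v \<noteq> 0"
  shows "(\<Sum>(a, b)\<in>quotient_set. pair_char u v a b) \<in> {of_real \<theta>\<^sub>1, of_real \<theta>\<^sub>2}"
proof -
  define c where "c = N L (- 1) * (N (Suc L) v / N L u)"
  have Nu: "N L u \<noteq> 0" "N (Suc L) v \<noteq> 0" using u v L by (auto simp: Nm_eq_0_iff)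
  have Kc: "N (Suc L) v / N L u \<in> K" "c \<in> K"
    using N_in_K[OF u(1)] N_in_K[OF v(1)] N_in_K[OF Fn_uminus[OF Fn_1], of L] Fn_divide[of _ 1] Fn_mult[of _ 1] K_eq
    unfolding c_def by metis+
  have s: "(\<Sum>a\<in>Fn L - {0}. \<chi> L (u * a)) = - 1"
    using \<chi>_sum_nonzero[OF L card_Fn_L u(1)] u(2) by simp
  have inner: "(\<Sum>a\<in>Fn L - {0}. \<Sum>b\<in>Fn (Suc L). if N (Suc L) b = y * N L a then pair_char u v a b else 0)
     = - of_nat (Q ^ L) * \<psi> (c * y) - of_nat (fibre_size L)" if y: "y \<in> R - {0}" for y
  proof -
    let ?y = "y * (N (Suc L) v / N L u)"
    have "(\<Sum>a\<in>Fn L - {0}. \<Sum>b\<in>Fn (Suc L). if N (Suc L) b = y * N L a then pair_char u v a b else 0)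
      = (\<Sum>a\<in>Fn L - {0}. \<Sum>b\<in>Fn (Suc L). if N (Suc L) b = ?y * N L a then \<chi> L a * \<chi> (Suc L) b else 0)"
    \<comment> \<open>Replacing a by u a and b by v b strips the twists from the characters and
      multiplies y by the quotient of the norms of v and u.\<close>
    proof (rule sum.reindex_bij_witness[of _ "\<lambda>a. a / u" "\<lambda>a. u * a"])
      fix a assume a: "a \<in> Fn L - {0}"
      show "(\<Sum>b\<in>Fn (Suc L). if N (Suc L) b = ?y * N L (u * a) then \<chi> L (u * a) * \<chi> (Suc L) b else 0)
        = (\<Sum>b\<in>Fn (Suc L). if N (Suc L) b = y * N L a then pair_char u v a b else 0)"
      proof (rule sum.reindex_bij_witness[of _ "\<lambda>b. v * b" "\<lambda>b. b / v"])
        fix b assume "b \<in> Fn (Suc L)"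
        have "N (Suc L) (b / v) = y * N L a \<longleftrightarrow> N (Suc L) b = ?y * N L (u * a)"
          using Nu by (auto simp: N_divide Nm_mult field_simps)
        then show "(if N (Suc L) (b / v) = y * N L a then pair_char u v a (b / v) else 0)
          = (if N (Suc L) b = ?y * N L (u * a) then \<chi> L (u * a) * \<chi> (Suc L) b else 0)"
          using v by (simp add: pair_char_def)
      qed (use v Fn_mult Fn_divide in auto)
    qed (use u Fn_mult Fn_divide in auto)
    also have "\<dots> = - of_nat (Q ^ L) * \<psi> (N L (- 1) * ?y) - of_nat (fibre_size L)"
    proof (rule norm_twisted_sum)
      have "?y \<in> K" using y R_sub Kc(1) unfolding K_eq by (intro Fn_mult) auto
      then show "?y \<in> K - {0}" using y Nu by simp
    qed
    also have "N L (- 1) * ?y = c * y" by (simp add: c_def)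
    finally show ?thesis .
  qed
  have "(\<Sum>(a, b)\<in>quotient_set. pair_char u v a b) = - 1 + (\<Sum>y\<in>R - {0}. - of_nat (Q ^ L) * \<psi> (c * y) - of_nat (fibre_size L))"
    unfolding sum_quotient_set using inner s by (simp add: pair_char_def)
  also have "\<dots> = - 1 - of_nat (Q ^ L) * (\<Sum>y\<in>R - {0}. \<psi> (c * y)) - of_nat \<rho> * of_nat (fibre_size L)"
    by (simp add: sum_subtractf sum_negf sum_distrib_left \<rho>_def)
  also have "(\<Sum>y\<in>R - {0}. \<psi> (c * y)) = (\<Sum>y\<in>R. \<psi> (c * y)) - 1"
    using finite_R R_0 by (simp add: sum_diff1 \<psi>_0)
  finally have eq: "(\<Sum>(a, b)\<in>quotient_set. pair_char u v a b) = - 1 - of_nat (Q ^ L) * ((\<Sum>y\<in>R. \<psi> (c * y)) - 1) - of_nat \<rho> * of_nat (fibre_size L)" .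
  show ?thesis
  proof (cases "\<forall>y\<in>R. \<psi> (c * y) = 1")
    case True
    then have "(\<Sum>y\<in>R. \<psi> (c * y)) = of_nat (Suc \<rho>)" by (simp add: card_R)
    then show ?thesis unfolding eq by (simp add: \<theta>\<^sub>2_def fibre_size_Suc algebra_simps)
  next
    case False
    then obtain z where z: "z \<in> R" "\<psi> (c * z) \<noteq> 1" by blast
    have cy: "c * y \<in> K" if "y \<in> R" for y using that R_sub Kc(2) Fn_mult[of c 1 y] K_eq by auto
    have "(\<Sum>y\<in>R. \<psi> (c * y)) = 0"
      by (rule additive_character_sum_eq_0[where z = z]) (use z R_add R_uminus in \<open>auto simp: distrib_left \<psi>_add cy\<close>)
    then show ?thesis unfolding eq by (simp add: \<theta>\<^sub>1_def)
  qed
qed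

lemma char_sum_values:
  assumes "u \<in> Fn L" "v \<in> Fn (Suc L)" "u \<noteq> 0 \<or> v \<noteq> 0"
  shows "((\<Sum>(a, b)\<in>quotient_set. pair_char u v a b) - of_real \<theta>\<^sub>1) * ((\<Sum>(a, b)\<in>quotient_set. pair_char u v a b) - of_real \<theta>\<^sub>2) = 0"
proof -
  have "(\<Sum>(a, b)\<in>quotient_set. pair_char u v a b) \<in> {of_real \<theta>\<^sub>1, of_real \<theta>\<^sub>2}"
    using assms char_sum_uv char_sum_u0 char_sum_0v by (cases "u = 0"; cases "v = 0") auto
  then show ?thesis by auto
qed

section \<open>Fourier inversion on the product of A and B, and the difference counts\<close>

lemma character_inversion:
  assumes n: "n \<ge> 1" and card: "card (Fn n) = Q ^ n" and x: "x \<in> Fn n"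
  shows "(\<Sum>u\<in>Fn n. \<chi> n (u * (- x)) * (\<Sum>a\<in>Fn n. h a * \<chi> n (u * a))) = of_nat (Q ^ n) * h x"
proof -
  have fin: "finite (Fn n)" using card Q2 by (auto intro!: card_ge_0_finite)
  have "(\<Sum>u\<in>Fn n. \<chi> n (u * (- x)) * (\<Sum>a\<in>Fn n. h a * \<chi> n (u * a)))
    = (\<Sum>u\<in>Fn n. \<Sum>a\<in>Fn n. h a * \<chi> n ((a - x) * u))"
    unfolding sum_distrib_left
  proof (intro sum.cong refl)
    fix u a assume "u \<in> Fn n" "a \<in> Fn n"
    then have "\<chi> n (u * (- x) + u * a) = \<chi> n (u * (- x)) * \<chi> n (u * a)"
      using x by (intro \<chi>_add Fn_mult Fn_uminus)
    moreover have "u * (- x) + u * a = (a - x) * u" by (simp add: algebra_simps)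
    ultimately show "\<chi> n (u * (- x)) * (h a * \<chi> n (u * a)) = h a * \<chi> n ((a - x) * u)" by simp
  qed
  also have "\<dots> = (\<Sum>a\<in>Fn n. h a * (\<Sum>u\<in>Fn n. \<chi> n ((a - x) * u)))"
    by (subst sum.swap) (simp add: sum_distrib_left)
  also have "\<dots> = (\<Sum>a\<in>Fn n. if a = x then h a * of_nat (Q ^ n) else 0)"
  proof (intro sum.cong refl)
    fix a assume "a \<in> Fn n"
    then have "a - x \<in> Fn n" using x Fn_add[of a n "- x"] Fn_uminus by simp
    from \<chi>_sum[OF n card this] show "h a * (\<Sum>u\<in>Fn n. \<chi> n ((a - x) * u)) = (if a = x then h a * of_nat (Q ^ n) else 0)"
      by simp
  qed
  also have "\<dots> = of_nat (Q ^ n) * h x" using fin x by simp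
  finally show ?thesis .
qed

text \<open>Inverting first in v and then in u expresses h at any point by its transform; only the
  term at (0, 0) survives, and it does not depend on the point.\<close>

lemma constant_if_hat_vanishes:
  assumes hat: "\<And>u v. u \<in> Fn L \<Longrightarrow> v \<in> Fn (Suc L) \<Longrightarrow> u \<noteq> 0 \<or> v \<noteq> 0 \<Longrightarrow>
      (\<Sum>a\<in>Fn L. \<Sum>b\<in>Fn (Suc L). h a b * pair_char u v a b) = 0"
    and x: "x \<in> Fn L" and y: "y \<in> Fn (Suc L)"
  shows "h x y = h 0 0"
proof -
  define H where "H u v = (\<Sum>a\<in>Fn L. \<Sum>b\<in>Fn (Suc L). h a b * pair_char u v a b)" for u v
  define V where "V v a = (\<Sum>b\<in>Fn (Suc L). h a b * \<chi> (Suc L) (v * b))" for v a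
  have H: "H u v = (\<Sum>a\<in>Fn L. V v a * \<chi> L (u * a))" for u v
    by (simp add: H_def V_def pair_char_def sum_distrib_left sum_distrib_right mult_ac)
  have "of_nat (Q ^ Suc L) * (of_nat (Q ^ L) * h x y) = H 0 0" if x: "x \<in> Fn L" and y: "y \<in> Fn (Suc L)" for x y
  proof -
    have inv: "of_nat (Q ^ Suc L) * h x y = (\<Sum>v\<in>Fn (Suc L). \<chi> (Suc L) (v * (- y)) * V v x)"
      unfolding V_def by (rule character_inversion[symmetric, OF _ card_Fn_Suc_L y]) simp
    have "of_nat (Q ^ Suc L) * (of_nat (Q ^ L) * h x y) = of_nat (Q ^ L) * (of_nat (Q ^ Suc L) * h x y)"
      by (simp only: mult_ac)
    also have "\<dots> = (\<Sum>v\<in>Fn (Suc L). \<chi> (Suc L) (v * (- y)) * (of_nat (Q ^ L) * V v x))"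
      unfolding inv sum_distrib_left by (intro sum.cong refl) (simp only: mult_ac)
    also have "\<dots> = (\<Sum>v\<in>Fn (Suc L). \<Sum>u\<in>Fn L. \<chi> (Suc L) (v * (- y)) * (\<chi> L (u * (- x)) * H u v))"
      unfolding character_inversion[OF L card_Fn_L x, symmetric] H sum_distrib_left ..
    also have "\<dots> = (\<Sum>v\<in>Fn (Suc L). \<Sum>u\<in>Fn L. if u = 0 then (if v = 0 then H 0 0 else 0) else 0)"
      using hat by (intro sum.cong) (auto simp: H_def)
    also have "\<dots> = H 0 0" using finite_Fn_L finite_Fn_Suc_L by simp
    finally show ?thesis .
  qed
  from this[OF x y] this[of 0 0] have "of_nat (Q ^ Suc L) * (of_nat (Q ^ L) * h x y) = of_nat (Q ^ Suc L) * (of_nat (Q ^ L) * h 0 0)"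
    by simp
  then show ?thesis using Q2 by simp
qed

text \<open>The norm of - 1 is 1 or - 1, and R is closed under negation. This gives both the
  symmetry of the graph and the square in \<open>sum_diff_count\<close>.\<close>

lemma quotient_set_uminus:
  assumes "(a, b) \<in> quotient_set"
  shows "(- a, - b) \<in> quotient_set"
proof -
  have sgn: "N n (- 1) = 1 \<or> N n (- 1) = - 1" for n
    using N_minus_1_squared[of n] by (simp add: square_eq_1_iff)
  have "N (Suc L) (- b) / N L (- a) = N (Suc L) (- 1) / N L (- 1) * (N (Suc L) b / N L a)"
    using Nm_mult[of Q "Suc L" "- 1" b] Nm_mult[of Q L "- 1" a] by simp
  also have "\<dots> \<in> R"
    using sgn[of L] sgn[of "Suc L"] R_uminus assms by (auto simp: quotient_set_def)
  finally show ?thesis using assms Fn_uminus by (auto simp: quotient_set_def)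
qed

text \<open>Pairs with equal components are allowed; they contribute only at the origin, where the
  count is the size of the set.\<close>

definition diff_count :: "'a \<Rightarrow> 'a \<Rightarrow> nat" where
  "diff_count x y = card {(g, h). g \<in> quotient_set \<and> h \<in> quotient_set \<and> fst g - fst h = x \<and> snd g - snd h = y}"

lemma quotient_set_sub: "quotient_set \<subseteq> Fn L \<times> Fn (Suc L)"
  by (auto simp: quotient_set_def)

text \<open>The transform of the difference counts is the character sum of the set times that of its
  negative, and the set equals its negative.\<close>

lemma sum_diff_count:
  assumes u: "u \<in> Fn L" and v: "v \<in> Fn (Suc L)"
  shows "(\<Sum>a\<in>Fn L. \<Sum>b\<in>Fn (Suc L). of_nat (diff_count a b) * pair_char u v a b)
    = (\<Sum>(a, b)\<in>quotient_set. pair_char u v a b)\<^sup>2"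
proof -
  have mult: "pair_char u v (a - a') (b - b') = pair_char u v a b * pair_char u v (- a') (- b')"
    if "a \<in> Fn L" "a' \<in> Fn L" "b \<in> Fn (Suc L)" "b' \<in> Fn (Suc L)" for a a' b b'
  proof -
    have "\<chi> L (u * a + u * (- a')) = \<chi> L (u * a) * \<chi> L (u * (- a'))"
      using that u by (intro \<chi>_add Fn_mult Fn_uminus)
    moreover have "\<chi> (Suc L) (v * b + v * (- b')) = \<chi> (Suc L) (v * b) * \<chi> (Suc L) (v * (- b'))"
      using that v by (intro \<chi>_add Fn_mult Fn_uminus)
    ultimately show ?thesis by (simp add: pair_char_def right_diff_distrib)
  qed
  have diff: "fst g - fst h \<in> Fn L" "snd g - snd h \<in> Fn (Suc L)" if "g \<in> quotient_set" "h \<in> quotient_set" for g h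
    using that quotient_set_sub Fn_add[of "fst g" L "- fst h"] Fn_add[of "snd g" "Suc L" "- snd h"] Fn_uminus
    by (auto simp: quotient_set_def)
  have "(\<Sum>a\<in>Fn L. \<Sum>b\<in>Fn (Suc L). of_nat (diff_count a b) * pair_char u v a b)
    = (\<Sum>z\<in>Fn L \<times> Fn (Suc L). of_nat (diff_count (fst z) (snd z)) * pair_char u v (fst z) (snd z))"
    by (simp add: sum.cartesian_product case_prod_unfold)
  \<comment> \<open>Each count is unfolded into the pairs with difference z, so that the sum over z
    can be merged into one over all pairs.\<close>
  also have "\<dots> = (\<Sum>z\<in>Fn L \<times> Fn (Suc L). \<Sum>(g, h)\<in>{p \<in> quotient_set \<times> quotient_set. (fst (fst p) - fst (snd p), snd (fst p) - snd (snd p)) = z}.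
      pair_char u v (fst g - fst h) (snd g - snd h))"
  proof (intro sum.cong refl)
    fix z
    have eq: "{(g, h). g \<in> quotient_set \<and> h \<in> quotient_set \<and> fst g - fst h = fst z \<and> snd g - snd h = snd z}
      = {p \<in> quotient_set \<times> quotient_set. (fst (fst p) - fst (snd p), snd (fst p) - snd (snd p)) = z}" by auto
    have "(\<Sum>(g, h)\<in>{p \<in> quotient_set \<times> quotient_set. (fst (fst p) - fst (snd p), snd (fst p) - snd (snd p)) = z}. pair_char u v (fst g - fst h) (snd g - snd h))
      = (\<Sum>p\<in>{p \<in> quotient_set \<times> quotient_set. (fst (fst p) - fst (snd p), snd (fst p) - snd (snd p)) = z}. pair_char u v (fst z) (snd z))"
      by (intro sum.cong) auto
    then show "of_nat (diff_count (fst z) (snd z)) * pair_char u v (fst z) (snd z) =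
      (\<Sum>(g, h)\<in>{p \<in> quotient_set \<times> quotient_set. (fst (fst p) - fst (snd p), snd (fst p) - snd (snd p)) = z}. pair_char u v (fst g - fst h) (snd g - snd h))"
      by (simp add: diff_count_def eq)
  qed
  also have "\<dots> = (\<Sum>(g, h)\<in>quotient_set \<times> quotient_set. pair_char u v (fst g - fst h) (snd g - snd h))"
    using finite_quotient_set finite_Fn_L finite_Fn_Suc_L diff by (intro sum.group) auto
  also have "\<dots> = (\<Sum>(g, h)\<in>quotient_set \<times> quotient_set. pair_char u v (fst g) (snd g) * pair_char u v (- fst h) (- snd h))"
    using quotient_set_sub by (intro sum.cong refl) (auto intro!: mult)
  also have "\<dots> = (\<Sum>g\<in>quotient_set. pair_char u v (fst g) (snd g)) * (\<Sum>h\<in>quotient_set. pair_char u v (- fst h) (- snd h))"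
    by (simp add: sum_product sum.cartesian_product)
  also have "(\<Sum>h\<in>quotient_set. pair_char u v (- fst h) (- snd h)) = (\<Sum>h\<in>quotient_set. pair_char u v (fst h) (snd h))"
    by (rule sum.reindex_bij_witness[of _ "\<lambda>h. (- fst h, - snd h)" "\<lambda>h. (- fst h, - snd h)"]) (auto intro: quotient_set_uminus)
  finally show ?thesis by (simp add: power2_eq_square case_prod_unfold)
qed

text \<open>The function h combines the difference counts, the indicator of the set and a point mass
  at the origin so that its transform is (S - \<open>\<theta>\<^sub>1\<close>) (S -
  \<open>\<theta>\<^sub>2\<close>), with S the character sum. This vanishes at nontrivial
  characters, so h is constant and its value is read off at the origin.\<close>

theorem diff_count_eq:
  assumes x: "x \<in> Fn L" and y: "y \<in> Fn (Suc L)" and nz: "(x, y) \<noteq> (0, 0)"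
  shows "real (diff_count x y) = real (card quotient_set) + \<theta>\<^sub>1 * \<theta>\<^sub>2 + (if (x, y) \<in> quotient_set then \<theta>\<^sub>1 + \<theta>\<^sub>2 else 0)"
proof -
  define h :: "'a \<Rightarrow> 'a \<Rightarrow> complex" where "h a b = of_nat (diff_count a b)
    - of_real (\<theta>\<^sub>1 + \<theta>\<^sub>2) * (if (a, b) \<in> quotient_set then 1 else 0) + of_real (\<theta>\<^sub>1 * \<theta>\<^sub>2) * (if a = 0 then if b = 0 then 1 else 0 else 0)" for a b
  have "h x y = h 0 0"
  proof (rule constant_if_hat_vanishes[OF _ x y])
    fix u v assume uv: "u \<in> Fn L" "v \<in> Fn (Suc L)" "u \<noteq> 0 \<or> v \<noteq> 0"
    define S where "S = (\<Sum>(a, b)\<in>quotient_set. pair_char u v a b)"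
    have S: "(\<Sum>a\<in>Fn L. \<Sum>b\<in>Fn (Suc L). if (a, b) \<in> quotient_set then pair_char u v a b else 0) = S"
    proof -
      have "(\<Sum>a\<in>Fn L. \<Sum>b\<in>Fn (Suc L). if (a, b) \<in> quotient_set then pair_char u v a b else 0)
        = (\<Sum>z\<in>Fn L \<times> Fn (Suc L). if z \<in> quotient_set then pair_char u v (fst z) (snd z) else 0)"
        by (simp add: sum.cartesian_product case_prod_unfold)
      also have "\<dots> = (\<Sum>z\<in>(Fn L \<times> Fn (Suc L)) \<inter> quotient_set. pair_char u v (fst z) (snd z))"
        using finite_Fn_L finite_Fn_Suc_L by (simp add: sum.inter_restrict)
      also have "(Fn L \<times> Fn (Suc L)) \<inter> quotient_set = quotient_set" using quotient_set_sub by blast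
      finally show ?thesis by (simp add: S_def case_prod_unfold)
    qed
    have "(\<Sum>a\<in>Fn L. \<Sum>b\<in>Fn (Suc L). h a b * pair_char u v a b)
      = (\<Sum>a\<in>Fn L. \<Sum>b\<in>Fn (Suc L). of_nat (diff_count a b) * pair_char u v a b
         - of_real (\<theta>\<^sub>1 + \<theta>\<^sub>2) * (if (a, b) \<in> quotient_set then pair_char u v a b else 0)
         + (if b = 0 then if a = 0 then of_real (\<theta>\<^sub>1 * \<theta>\<^sub>2) else 0 else 0))"
      by (intro sum.cong refl) (auto simp: h_def pair_char_def algebra_simps)
    also have "\<dots> = S\<^sup>2 - of_real (\<theta>\<^sub>1 + \<theta>\<^sub>2) * S + of_real (\<theta>\<^sub>1 * \<theta>\<^sub>2)"
      using finite_Fn_L finite_Fn_Suc_L sum_diff_count[OF uv(1,2)] S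
      by (simp add: sum.distrib sum_subtractf S_def flip: sum_distrib_left)
    also have "\<dots> = (S - of_real \<theta>\<^sub>1) * (S - of_real \<theta>\<^sub>2)"
      by (simp add: algebra_simps power2_eq_square)
    also have "\<dots> = 0" unfolding S_def by (rule char_sum_values[OF uv])
    finally show "(\<Sum>a\<in>Fn L. \<Sum>b\<in>Fn (Suc L). h a b * pair_char u v a b) = 0" .
  qed
  moreover have "diff_count 0 0 = card quotient_set"
  proof -
    have "{(g, h). g \<in> quotient_set \<and> h \<in> quotient_set \<and> fst g - fst h = 0 \<and> snd g - snd h = 0} = (\<lambda>g. (g, g)) ` quotient_set" by auto
    then show ?thesis by (simp add: diff_count_def card_image inj_on_def)
  qed
  moreover have "(0, 0) \<notin> quotient_set" by (simp add: quotient_set_def)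
  ultimately have "complex_of_real (real (diff_count x y)) = complex_of_real (real (card quotient_set) + \<theta>\<^sub>1 * \<theta>\<^sub>2 + (if (x, y) \<in> quotient_set then \<theta>\<^sub>1 + \<theta>\<^sub>2 else 0))"
    using nz by (auto simp: h_def algebra_simps split: if_splits)
  then show ?thesis by (simp only: of_real_eq_iff)
qed

end

section \<open>Finite subfields and cyclotomic classes\<close>

context
  fixes F :: "'f::field set"
  assumes sf: "subfield F (ring_of_type_algebra :: 'f ring)"
begin

lemma subfield_card_ge_2: "finite F \<Longrightarrow> card F \<ge> 2"
  using card_mono[of F "{0, 1}"] subfield_0[OF sf] subfield_1[OF sf] by simp

text \<open>Multiplication by a nonzero x permutes the nonzero elements; comparing their products
  gives Fermat's identity.\<close>

lemma subfield_power_card: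
  assumes fin: "finite F" and x: "x \<in> F"
  shows "x ^ card F = x"
proof (cases "x = 0")
  case True
  then show ?thesis using subfield_card_ge_2[OF fin] by (simp add: power_0_left)
next
  case False
  let ?P = "\<Prod>y\<in>F - {0}. y"
  have "(\<lambda>y. x * y) ` (F - {0}) = F - {0}"
  proof (rule card_subset_eq)
    show "(\<lambda>y. x * y) ` (F - {0}) \<subseteq> F - {0}" using False x subfield_mult[OF sf] by auto
    show "card ((\<lambda>y. x * y) ` (F - {0})) = card (F - {0})"
      using False by (intro card_image) (auto simp: inj_on_def)
  qed (use fin in simp)
  then have "?P = (\<Prod>y\<in>(\<lambda>y. x * y) ` (F - {0}). y)" by simp
  also have "\<dots> = (\<Prod>y\<in>F - {0}. x * y)"
    using False by (subst prod.reindex) (auto simp: inj_on_def)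
  also have "\<dots> = x ^ card (F - {0}) * ?P" by (simp add: prod.distrib)
  finally have "x ^ card (F - {0}) = 1" using fin by simp
  then have "x ^ (card F - 1) = 1" using fin subfield_0[OF sf] by (simp add: card_Diff_singleton)
  then have "x * x ^ (card F - 1) = x" by simp
  moreover have "card F = Suc (card F - 1)" using subfield_card_ge_2[OF fin] by simp
  ultimately show ?thesis by (metis power_Suc)
qed

text \<open>All elements of F satisfy the equation, and it has no more than \<open>card F\<close>
  solutions.\<close>

lemma subfield_eq_fixed_points:
  assumes fin: "finite F"
  shows "F = {x. x ^ card F = x}"
  using fixed_points_finite[OF subfield_card_ge_2[OF fin], where 'a = 'f] subfield_power_card[OF fin]
  by (intro card_seteq) auto

lemma subfield_divide:
  assumes fin: "finite F" and "x \<in> F" "y \<in> F"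
  shows "x / y \<in> F"
proof -
  have "(x / y) ^ card F = x / y" using assms by (simp add: power_divide subfield_power_card)
  then show ?thesis by (subst subfield_eq_fixed_points[OF fin]) simp
qed

text \<open>Translation by 1 permutes F, and comparing the sums of all elements shows that
  \<open>card F\<close> is zero in the field.\<close>

lemma CHAR_eq_of_subfield:
  assumes "card F = p ^ s" "prime p"
  shows "CHAR('f) = p"
proof -
  have fin: "finite F" using assms by (intro card_ge_0_finite) (simp add: prime_gt_0_nat)
  have "(\<lambda>y. 1 + y) ` F = F"
  proof (rule card_subset_eq)
    show "(\<lambda>y. 1 + y) ` F \<subseteq> F" using subfield_add[OF sf subfield_1[OF sf]] by auto
    show "card ((\<lambda>y. 1 + y) ` F) = card F" by (intro card_image) (auto simp: inj_on_def)
  qed (use fin in simp)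
  then have "(\<Sum>y\<in>F. y) = (\<Sum>y\<in>(\<lambda>y. 1 + y) ` F. y)" by simp
  also have "\<dots> = (\<Sum>y\<in>F. 1 + y)" by (subst sum.reindex) (auto simp: inj_on_def)
  also have "\<dots> = of_nat (card F) + (\<Sum>y\<in>F. y)" by (simp add: sum.distrib)
  finally have "of_nat p ^ s = (0::'f)" using assms by simp
  then have "of_nat p = (0::'f)" by simp
  then have "CHAR('f) dvd p" by (simp add: of_nat_eq_0_iff_char_dvd)
  then have "CHAR('f) = 1 \<or> CHAR('f) = p" using assms(2) prime_nat_iff by blast
  then show ?thesis by simp
qed

end

text \<open>Induction along the line extensions defining the dimension. The order is multiplied by
  \<open>card F\<close> each time because a second representation k v + w of the same element could
  be solved for v, which lies outside E.\<close>

lemma subspace_facts: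
  fixes F :: "'f::field set"
  assumes sf: "subfield F (ring_of_type_algebra :: 'f ring)" and fin: "finite F" and "ring.dimension (ring_of_type_algebra :: 'f ring) r F R" (is "?dim")
  shows "0 \<in> R" and "\<And>x y. x \<in> R \<Longrightarrow> y \<in> R \<Longrightarrow> x + y \<in> R" and "\<And>c x. c \<in> F \<Longrightarrow> x \<in> R \<Longrightarrow> c * x \<in> R"
    and "card R = card F ^ r"
proof -
  interpret ring "ring_of_type_algebra :: 'f ring" by (rule ring_from_type_algebra)
  have [simp]: "\<zero>\<^bsub>ring_of_type_algebra\<^esub> = (0::'f)"
    "\<And>x y. x \<oplus>\<^bsub>ring_of_type_algebra\<^esub> y = x + (y::'f)" "\<And>x y. x \<otimes>\<^bsub>ring_of_type_algebra\<^esub> y = x * (y::'f)"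
    by (auto simp: ring_of_type_algebra_def)
  have "0 \<in> R \<and> (\<forall>x\<in>R. \<forall>y\<in>R. x + y \<in> R) \<and> (\<forall>c\<in>F. \<forall>x\<in>R. c * x \<in> R) \<and> card R = card F ^ r"
    using \<open>?dim\<close> fin sf
  proof (induction r F R rule: dimension.induct)
    case (zero_dim F)
    then show ?case by simp
  next
    case (Suc_dim v E n F)
    note sf = \<open>subfield F ring_of_type_algebra\<close>
    have E: "0 \<in> E" "\<And>x y. x \<in> E \<Longrightarrow> y \<in> E \<Longrightarrow> x + y \<in> E" "\<And>c x. c \<in> F \<Longrightarrow> x \<in> E \<Longrightarrow> c * x \<in> E"
      and cE: "card E = card F ^ n" using Suc_dim by auto
    have mem: "x \<in> line_extension F v E \<longleftrightarrow> (\<exists>k\<in>F. \<exists>w\<in>E. x = k * v + w)" for x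
      by (simp add: line_extension_mem_iff)
    have "0 \<in> line_extension F v E"
      unfolding mem using E(1) subfield_0[OF sf] by (intro bexI[of _ 0]) auto
    moreover have "x + y \<in> line_extension F v E" if "x \<in> line_extension F v E" "y \<in> line_extension F v E" for x y
    proof -
      obtain k w k' w' where "k \<in> F" "w \<in> E" "x = k * v + w" "k' \<in> F" "w' \<in> E" "y = k' * v + w'"
        using \<open>x \<in> _\<close> \<open>y \<in> _\<close> unfolding mem by blast
      then show ?thesis unfolding mem using E(2) subfield_add[OF sf]
        by (intro bexI[of _ "k + k'"] bexI[of _ "w + w'"]) (auto simp: algebra_simps)
    qed
    moreover have "c * x \<in> line_extension F v E" if "c \<in> F" "x \<in> line_extension F v E" for c x
    proof -
      obtain k w where "k \<in> F" "w \<in> E" "x = k * v + w" using \<open>x \<in> _\<close> unfolding mem by blast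
      then show ?thesis unfolding mem using E(3) subfield_mult[OF sf] \<open>c \<in> F\<close>
        by (intro bexI[of _ "c * k"] bexI[of _ "c * w"]) (auto simp: algebra_simps)
    qed
    moreover have "card (line_extension F v E) = card F ^ Suc n"
    proof -
      have "line_extension F v E = (\<lambda>(k, w). k * v + w) ` (F \<times> E)"
        by (intro equalityI subsetI) (auto simp: mem image_iff)
      moreover have "inj_on (\<lambda>(k, w). k * v + w) (F \<times> E)"
      proof (rule inj_onI, clarify)
        fix k w k' w' assume *: "k \<in> F" "w \<in> E" "k' \<in> F" "w' \<in> E" "k * v + w = k' * v + w'"
        have neg: "- x \<in> E" if "x \<in> E" for x
          using E(3)[OF subfield_uminus[OF sf subfield_1[OF sf]] that] by simp
        have "k = k'"
        proof (rule ccontr)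
          assume "k \<noteq> k'"
          have "(k - k') * v = w' + - w" using *(5) by (simp add: algebra_simps)
          then have "v = 1 / (k - k') * (w' + - w)" using \<open>k \<noteq> k'\<close> by (simp add: field_simps)
          also have "\<dots> \<in> E"
          proof (rule E(3))
            have "k - k' \<in> F" using subfield_add[OF sf *(1) subfield_uminus[OF sf *(3)]] by simp
            then show "1 / (k - k') \<in> F"
              using subfield_divide[OF sf Suc_dim.prems(1) subfield_1[OF sf]] by blast
          qed (rule E(2)[OF *(4) neg[OF *(2)]])
          finally show False using \<open>v \<notin> E\<close> by simp
        qed
        with * show "k = k' \<and> w = w'" by simp
      qed
      ultimately show ?thesis using cE by (simp add: card_image card_cartesian_product)
    qed
    ultimately show ?case by blast
  qed
  then show "0 \<in> R" "\<And>x y. x \<in> R \<Longrightarrow> y \<in> R \<Longrightarrow> x + y \<in> R" "\<And>c x. c \<in> F \<Longrightarrow> x \<in> R \<Longrightarrow> c * x \<in> R"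
    "card R = card F ^ r" by auto
qed

section \<open>Primitive elements, cyclotomic classes and norms\<close>

lemma primitive_element_nonzero:
  assumes "primitive_element F w"
  shows "w \<noteq> 0"
proof -
  have "w powi 1 \<in> cyclic_subgroup w" unfolding cyclic_subgroup_def by (rule rangeI)
  then show ?thesis using assms by (simp add: primitive_element_def)
qed

text \<open>Exponents from 0 to \<open>card F\<close> - 2 already exhaust the nonzero elements, so
  by counting these powers are distinct and the order of w is exactly \<open>card F\<close> -
  1.\<close>

lemma primitive_element_powi_eq_1:
  fixes F :: "'f::field set"
  assumes sf: "subfield F (ring_of_type_algebra :: 'f ring)" and fin: "finite F" and w: "primitive_element F w" and z: "w powi z = 1"
  shows "int (card F - 1) dvd z"
proof -
  define M where "M = card F - 1"
  have M: "M \<ge> 1" using subfield_card_ge_2[OF sf fin] by (simp add: M_def)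
  have w0: "w \<noteq> 0" using primitive_element_nonzero[OF w] .
  have "w ^ Suc M = w" using subfield_power_card[OF sf fin, of w] w subfield_card_ge_2[OF sf fin]
    by (simp add: M_def primitive_element_def)
  then have wM: "w ^ M = 1" using w0 by simp
  have red: "w powi a = w powi (a mod int M)" for a
  proof -
    have "w powi (int M * (a div int M) + a mod int M) = (w powi int M) powi (a div int M) * w powi (a mod int M)"
      using w0 by (subst power_int_add) (auto simp: power_int_mult)
    then show ?thesis by (simp add: wM)
  qed
  have "F - {0} = (\<lambda>a. w powi a) ` {0..<int M}"
  proof -
    have "range (\<lambda>a. w powi a) = (\<lambda>a. w powi a) ` {0..<int M}"
    proof (intro equalityI subsetI)
      fix x assume "x \<in> range (\<lambda>a. w powi a)"
      then obtain a where "x = w powi a" by blast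
      then have "x = w powi (a mod int M)" using red by simp
      moreover have "a mod int M \<in> {0..<int M}" using M by simp
      ultimately show "x \<in> (\<lambda>a. w powi a) ` {0..<int M}" by blast
    qed auto
    then show ?thesis using w by (simp add: primitive_element_def cyclic_subgroup_def)
  qed
  moreover have "card (F - {0}) = M" using fin subfield_0[OF sf] by (simp add: M_def)
  ultimately have "inj_on (\<lambda>a. w powi a) {0..<int M}" by (intro eq_card_imp_inj_on) auto
  moreover have "w powi (z mod int M) = w powi 0" using z red by simp
  ultimately have "z mod int M = 0" using M by (auto dest: inj_onD[of _ _ "z mod int M" 0])
  then show ?thesis by (auto simp: M_def)
qed

lemma mem_cyclotomic_class:
  assumes "w \<noteq> 0"
  shows "x \<in> cyclotomic_class e w i \<longleftrightarrow> (\<exists>j. x = w powi (int i + int e * j))"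
  using assms
  by (auto simp: cyclotomic_class_def cyclic_subgroup_def power_int_add power_int_power image_iff)

lemma field_norm_eq_Nm:
  assumes "q \<ge> 2" "m \<ge> 1"
  shows "field_norm q (m * n) m = Nm (q ^ m) n"
proof -
  have "q ^ m \<ge> 2" using assms self_le_power[of q m] by linarith
  then show ?thesis by (auto simp: field_norm_def Nm_eq_power_div fun_eq_iff power_mult)
qed

lemma Nm_powi: "Nm Q n (x powi z) = Nm Q n x powi z"
  by (simp add: Nm_eq_power power_int_power power_int_power' mult.commute)

text \<open>Two elements of one class differ by a factor in \<open>Fq\<close>, and R is closed under
  such factors. Hence R contains a whole class as soon as it contains the representative
  \<open>\<gamma> ^ t\<close>.\<close>

lemma cyclotomic_union_eq_subspace:
  fixes K Fq R :: "'f::field set"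
  assumes K: "subfield K (ring_of_type_algebra :: 'f ring)" "card K = q ^ m"
    and Fq: "subfield Fq (ring_of_type_algebra :: 'f ring)" "card Fq = q" and q: "q \<ge> 2" and m: "m \<ge> 1"
    and e: "e = (q ^ m - 1) div (q - 1)" and \<gamma>: "primitive_element K \<gamma>"
    and R: "R \<subseteq> K" "\<And>c x. c \<in> Fq \<Longrightarrow> x \<in> R \<Longrightarrow> c * x \<in> R"
  shows "(\<Union>t\<in>{i. i < e \<and> \<gamma> ^ i \<in> R}. cyclotomic_class e \<gamma> t) = R - {0}"
proof -
  have fin: "finite K" "finite Fq" using K(2) Fq(2) q by (auto intro!: card_ge_0_finite)
  have \<gamma>0: "\<gamma> \<noteq> 0" using primitive_element_nonzero[OF \<gamma>] .
  have eq: "e * (q - 1) = q ^ m - 1"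
    unfolding e using geometric_sum_mult[of q m] by (metis dvd_div_mult_self dvd_triv_left)
  have qm: "q ^ m \<ge> 2" using q m self_le_power[of q m] by linarith
  have e0: "e > 0" using eq qm by (intro Nat.gr0I) auto
  \<comment> \<open>Since e (q - 1) is the order of the multiplicative group of K, these powers are
    fixed by the q-th power map, which characterises \<open>Fq\<close>.\<close>
  have pow: "\<gamma> powi (int e * j) \<in> Fq" for j
  proof -
    have "Suc (q ^ m - 1) = q ^ m" using qm by simp
    then have "\<gamma> ^ Suc (q ^ m - 1) = \<gamma>"
      using subfield_power_card[OF K(1) fin(1), of \<gamma>] \<gamma> unfolding K(2) primitive_element_def by metis
    then have "\<gamma> ^ (e * (q - 1)) = 1" using \<gamma>0 unfolding eq by simp
    then have "(\<gamma> powi (int e * j)) ^ (q - 1) = 1"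
    proof -
      have "(\<gamma> powi (int e * j)) ^ (q - 1) = (\<gamma> ^ (e * (q - 1))) powi j"
        by (simp add: power_int_power power_int_power' mult_ac)
      then show ?thesis using \<open>\<gamma> ^ (e * (q - 1)) = 1\<close> by simp
    qed
    then have "(\<gamma> powi (int e * j)) ^ Suc (q - 1) = \<gamma> powi (int e * j)" by simp
    then show ?thesis
      using q by (subst subfield_eq_fixed_points[OF Fq(1) fin(2)]) (simp add: Fq(2))
  qed
  show ?thesis
  proof (intro equalityI subsetI)
    fix x assume "x \<in> (\<Union>t\<in>{i. i < e \<and> \<gamma> ^ i \<in> R}. cyclotomic_class e \<gamma> t)"
    then obtain t j where t: "\<gamma> ^ t \<in> R" and x: "x = \<gamma> powi (int t + int e * j)"
      using mem_cyclotomic_class[OF \<gamma>0] by blast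
    have "x = \<gamma> powi (int e * j) * \<gamma> ^ t" unfolding x using \<gamma>0 by (simp add: power_int_add)
    also have "\<dots> \<in> R" using R(2)[OF pow t] .
    finally show "x \<in> R - {0}" using x \<gamma>0 by simp
  next
    fix x assume x: "x \<in> R - {0}"
    then have "x \<in> cyclic_subgroup \<gamma>" using \<gamma> R(1) by (auto simp: primitive_element_def)
    then obtain z where z: "x = \<gamma> powi z" by (auto simp: cyclic_subgroup_def)
    define i where "i = nat (z mod int e)"
    have i: "int i = z mod int e" "i < e" using e0 by (auto simp: i_def nat_less_iff)
    have zi: "z = int i + int e * (z div int e)" using i by simp
    have "\<gamma> powi (int e * (- (z div int e))) * x = \<gamma> powi (int e * (- (z div int e)) + z)"
      unfolding z using \<gamma>0 by (intro power_int_add[symmetric]) simp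
    also have "int e * (- (z div int e)) + z = int i" using zi by (simp add: algebra_simps)
    finally have "\<gamma> ^ i \<in> R" using R(2)[OF pow, of x] x by (metis Diff_iff power_int_of_nat)
    moreover have "x \<in> cyclotomic_class e \<gamma> i"
      unfolding mem_cyclotomic_class[OF \<gamma>0] using z zi by metis
    ultimately show "x \<in> (\<Union>t\<in>{i. i < e \<and> \<gamma> ^ i \<in> R}. cyclotomic_class e \<gamma> t)" using i(2) by blast
  qed
qed

text \<open>With a and b the powers of \<open>\<alpha>\<close> and \<open>\<beta>\<close> with
  exponents x and y, the norm quotient is \<open>\<gamma> powi (y - x)\<close>. Both sides then say
  that y - x is congruent modulo e to some t in T; exponents of \<open>\<gamma>\<close> determine
  this congruence because e divides \<open>card K - 1\<close>.\<close>

lemma cyclotomic_product_eq_norm_quotient: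
  fixes A B K :: "'f::field set"
  assumes K: "subfield K (ring_of_type_algebra :: 'f ring)" "finite K" and e: "e > 0" "e dvd card K - 1"
    and \<gamma>: "primitive_element K \<gamma>" and \<alpha>: "primitive_element A \<alpha>" and \<beta>: "primitive_element B \<beta>"
    and N: "Nm Q n \<alpha> = \<gamma>" "Nm Q n' \<beta> = \<gamma>"
  shows "(\<Union>i<e. cyclotomic_class e \<alpha> i \<times> (\<Union>t\<in>T. cyclotomic_class e \<beta> ((i + t) mod e)))
    = {(a, b). a \<in> A \<and> b \<in> B \<and> a * b \<noteq> 0 \<and> Nm Q n' b / Nm Q n a \<in> (\<Union>t\<in>T. cyclotomic_class e \<gamma> t)}"
    (is "?L = ?R")
proof -
  have nz: "\<alpha> \<noteq> 0" "\<beta> \<noteq> 0" "\<gamma> \<noteq> 0"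
    using primitive_element_nonzero[OF \<alpha>] primitive_element_nonzero[OF \<beta>] primitive_element_nonzero[OF \<gamma>]
    by auto
  note mem = mem_cyclotomic_class[OF nz(1)] mem_cyclotomic_class[OF nz(2)] mem_cyclotomic_class[OF nz(3)]
  have A: "A - {0} = range (\<lambda>z. \<alpha> powi z)" and B: "B - {0} = range (\<lambda>z. \<beta> powi z)"
    using \<alpha> \<beta> by (auto simp: primitive_element_def cyclic_subgroup_def)
  have quot: "Nm Q n' (\<beta> powi y) / Nm Q n (\<alpha> powi x) = \<gamma> powi (y - x)" for x y
    using nz by (simp add: Nm_powi N power_int_diff)
  show ?thesis
  proof (intro equalityI subsetI)
    fix p assume "p \<in> ?L"
    then obtain i t j j' where t: "t \<in> T" and p: "p = (\<alpha> powi (int i + int e * j), \<beta> powi (int ((i + t) mod e) + int e * j'))"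
      by (auto simp: mem)
    let ?x = "int i + int e * j" and ?y = "int ((i + t) mod e) + int e * j'"
    \<comment> \<open>Reducing the index modulo e changes the exponent by a multiple of e, which
      stays inside the class.\<close>
    have "int ((i + t) mod e) = int i + int t - int e * (int (i + t) div int e)"
      by (simp only: zmod_int minus_mult_div_eq_mod flip: of_nat_add)
    then have "?y - ?x = int t + int e * (j' - j - int (i + t) div int e)"
      by (simp add: algebra_simps)
    then have "\<gamma> powi (?y - ?x) \<in> cyclotomic_class e \<gamma> t" unfolding mem by metis
    moreover have "\<alpha> powi ?x \<in> A - {0}" "\<beta> powi ?y \<in> B - {0}" unfolding A B by auto
    ultimately show "p \<in> ?R" using t unfolding p by (auto simp: quot)
  next
    fix p assume "p \<in> ?R"
    then obtain a b t where p: "p = (a, b)" and ab: "a \<in> A - {0}" "b \<in> B - {0}" and t: "t \<in> T"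
      and ct: "Nm Q n' b / Nm Q n a \<in> cyclotomic_class e \<gamma> t" by auto
    obtain x y where x: "a = \<alpha> powi x" and y: "b = \<beta> powi y" using ab unfolding A B by blast
    obtain j where "\<gamma> powi (y - x) = \<gamma> powi (int t + int e * j)"
      using ct unfolding x y quot mem by blast
    then have "\<gamma> powi (y - x - (int t + int e * j)) = 1" using nz by (simp add: power_int_diff)
    then have "int (card K - 1) dvd y - x - (int t + int e * j)"
      by (rule primitive_element_powi_eq_1[OF K \<gamma>])
    then have "int e dvd y - x - (int t + int e * j)" using e(2) by (meson dvd_trans int_dvd_int_iff)
    then have "int e dvd (y - x - (int t + int e * j)) + int e * j" by (intro dvd_add) auto
    also have "(y - x - (int t + int e * j)) + int e * j = y - (x + int t)" by simp
    finally have "int e dvd y - (x + int t)" .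
    then have ye: "y mod int e = (x + int t) mod int e" by (simp add: mod_eq_dvd_iff)
    define i where "i = nat (x mod int e)"
    have i: "int i = x mod int e" "i < e" using e(1) by (auto simp: i_def nat_less_iff)
    have "int ((i + t) mod e) = y mod int e" by (simp add: zmod_int i(1) ye mod_add_left_eq)
    then have "y = int ((i + t) mod e) + int e * (y div int e)" by simp
    moreover have "x = int i + int e * (x div int e)" using i(1) by simp
    ultimately have "a \<in> cyclotomic_class e \<alpha> i" "b \<in> cyclotomic_class e \<beta> ((i + t) mod e)"
      unfolding mem x y by metis+
    then show "p \<in> ?L" using p t i(2) by blast
  qed
qed

section \<open>The partial difference set, its graph and the maximum clique\<close>

theorem theorem3p1:
  fixes p s q m l e r :: nat
    and Fq K A B R :: "'f::field set"
    and \<alpha> \<beta> \<gamma> :: 'f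
    and T :: "nat set"
    and D :: "('f \<times> 'f) set"
    and G :: "('f \<times> 'f) monoid"
  assumes "prime p" and "s \<ge> 1" and q: "q = p ^ s"
    and "m \<ge> 1" and "l \<ge> 1"
    and e: "e = (q ^ m - 1) div (q - 1)"
    and "subfield Fq (ring_of_type_algebra :: 'f ring)" and "card Fq = q"
    and "subfield K (ring_of_type_algebra :: 'f ring)" and "card K = q ^ m"
    and "subfield A (ring_of_type_algebra :: 'f ring)" and "card A = q ^ (m * l)"
    and "subfield B (ring_of_type_algebra :: 'f ring)" and "card B = q ^ (m * (l + 1))"
    and "primitive_element K \<gamma>"
    and "primitive_element A \<alpha>"
    and "primitive_element B \<beta>"
    and "field_norm q (m * l) m \<alpha> = \<gamma>"
    and "field_norm q (m * (l + 1)) m \<beta> = \<gamma>"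
    and "r \<le> m"
    and "R \<subseteq> K" and "ring.dimension (ring_of_type_algebra :: 'f ring) r Fq R"
    and T: "T = {i. i < e \<and> \<gamma> ^ i \<in> R}"
    and D: "D = (\<Union>i<e. cyclotomic_class e \<alpha> i \<times>
                          (\<Union>t\<in>T. cyclotomic_class e \<beta> ((i + t) mod e)))
                 \<union> (A - {0}) \<times> {0}"
    and G: "G = additive_group A \<times>\<times> additive_group B"
  shows "G \<cong> product_group {..<s * m * (2 * l + 1)} (\<lambda>_. integer_mod_group p)
    \<and> (\<exists>v k lam mu :: nat.
          v = q ^ (m * (2 * l + 1))
        \<and> real k = (real q ^ r - 1) * (real q ^ (m * l) - 1) * (real q ^ (m * (l + 1)) - 1)
                     / (real q ^ m - 1) + real q ^ (m * l) - 1
        \<and> real lam = (real q ^ r - 1) * (real q ^ (m * (l + 1)) - 1) / (real q ^ m - 1)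
                       * ((real q ^ r - 1) * (real q ^ (m * l) - 1) / (real q ^ m - 1) - 1)
                     + real q ^ (m * l) - 2
        \<and> real mu = (real q ^ r - 1) * (real q ^ (m * l) - 1) / (real q ^ m - 1)
                      * ((real q ^ r - 1) * (real q ^ (m * (l + 1)) - 1) / (real q ^ m - 1) + 1)
        \<and> partial_difference_set G D v k lam mu
        \<and> strongly_regular_graph (Cay G D) v k lam mu)
    \<and> D = {(a, b). a \<in> A \<and> b \<in> B \<and> a * b \<noteq> 0 \<and>
               field_norm q (m * (l + 1)) m b / field_norm q (m * l) m a
                 \<in> (\<Union>t\<in>T. cyclotomic_class e \<gamma> t)}
           \<union> {(a, 0) |a. a \<in> A - {0}}
    \<and> D = {(a, b). a \<in> A \<and> b \<in> B \<and> a * b \<noteq> 0 \<and>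
               field_norm q (m * (l + 1)) m b / field_norm q (m * l) m a \<in> R - {0}}
           \<union> {(a, 0) |a. a \<in> A - {0}}
    \<and> maximum_clique (Cay G D) (A \<times> {0})
    \<and> card (A \<times> {0 :: 'f}) = q ^ (m * l)"
proof -
  define Q where "Q = q ^ m"
  have q2: "q \<ge> 2"
    using prime_ge_2_nat[OF \<open>prime p\<close>] \<open>s \<ge> 1\<close> self_le_power[of p s] unfolding q by linarith
  have Q2: "Q \<ge> 2" using q2 \<open>m \<ge> 1\<close> self_le_power[of q m] unfolding Q_def by linarith
  have cK: "card K = Q" and cA: "card A = Q ^ l" and cB: "card B = Q ^ Suc l"
    using \<open>card K = q ^ m\<close> \<open>card A = q ^ (m * l)\<close> \<open>card B = q ^ (m * (l + 1))\<close>
    by (simp_all only: Q_def power_mult[symmetric] Suc_eq_plus1)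
  have fin: "finite Fq" "finite K" "finite A" "finite B"
    using cK cA cB Q2 q2 \<open>card Fq = q\<close> by (auto intro!: card_ge_0_finite)
  have sub: "subfield Fq (ring_of_type_algebra :: 'f ring)" "subfield K (ring_of_type_algebra :: 'f ring)"
    "subfield A (ring_of_type_algebra :: 'f ring)" "subfield B (ring_of_type_algebra :: 'f ring)" by fact+
  have char: "CHAR('f) = p"
    using CHAR_eq_of_subfield[OF sub(1), of p s] \<open>card Fq = q\<close> q \<open>prime p\<close> by simp
  have p0: "of_nat p = (0::'f)" using char by (metis of_nat_CHAR)
  have cg: "comm_group (additive_group F)" if "subfield F (ring_of_type_algebra :: 'f ring)" for F :: "'f set"
    using subfield_0[OF that] subfield_add[OF that] subfield_uminus[OF that] by (rule comm_group_additive_group)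
  have QP: "Q = p ^ (s * m)" by (simp add: Q_def q power_mult)
  have sm: "s * m \<ge> 1" using \<open>s \<ge> 1\<close> \<open>m \<ge> 1\<close> by simp
  obtain \<psi> :: "'f \<Rightarrow> complex" where \<psi>: "\<And>x y. x \<in> K \<Longrightarrow> y \<in> K \<Longrightarrow> \<psi> (x + y) = \<psi> x * \<psi> y" "\<psi> 0 = 1" "\<exists>z\<in>K. \<psi> z \<noteq> 1"
    using ex_additive_character[OF cg[OF sub(2)] fin(2) cK[unfolded QP] \<open>prime p\<close> p0 sm] by blast
  note R = subspace_facts[OF sub(1) fin(1) \<open>ring.dimension ring_of_type_algebra r Fq R\<close>]
  have R_uminus: "- x \<in> R" if "x \<in> R" for x
    using R(3)[OF subfield_uminus[OF sub(1) subfield_1[OF sub(1)]] that] by simp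
  interpret norm_quotient_set Q l p "s * m" K A B \<psi> R
  proof unfold_locales
    show "K = {x. x ^ Q = x}" "A = {x. x ^ Q ^ l = x}" "B = {x. x ^ Q ^ Suc l = x}"
      using subfield_eq_fixed_points[OF sub(2) fin(2)] subfield_eq_fixed_points[OF sub(3) fin(3)]
        subfield_eq_fixed_points[OF sub(4) fin(4)] unfolding cK cA cB by auto
    show "\<psi> (x + y) = \<psi> x * \<psi> y" if "x \<in> K" "y \<in> K" for x y using that by (rule \<psi>(1))
    show "x + y \<in> R" if "x \<in> R" "y \<in> R" for x y using that by (rule R(2))
  qed (use \<open>prime p\<close> char QP sm \<open>l \<ge> 1\<close> cK cA cB \<psi>(2,3) \<open>R \<subseteq> K\<close> R(1) R_uminus in auto)

  have fn: "field_norm q (m * n) m = (Nm Q n :: 'f \<Rightarrow> 'f)" for n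
    unfolding Q_def by (rule field_norm_eq_Nm[OF q2 \<open>m \<ge> 1\<close>])
  have e_mult: "e * (q - 1) = q ^ m - 1"
    unfolding e using geometric_sum_mult[of q m] by (metis dvd_div_mult_self dvd_triv_left)
  have e0: "e > 0" using e_mult Q2 unfolding Q_def by (intro Nat.gr0I) auto
  have eK: "e dvd card K - 1" unfolding cK Q_def e_mult[symmetric] by simp
  have union: "(\<Union>t\<in>T. cyclotomic_class e \<gamma> t) = R - {0}"
    unfolding T using cyclotomic_union_eq_subspace[OF sub(2) \<open>card K = q ^ m\<close> sub(1) \<open>card Fq = q\<close> q2 \<open>m \<ge> 1\<close> e
      \<open>primitive_element K \<gamma>\<close> \<open>R \<subseteq> K\<close> R(3)] .
  have D1: "D = {(a, b). a \<in> A \<and> b \<in> B \<and> a * b \<noteq> 0 \<and>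
               field_norm q (m * (l + 1)) m b / field_norm q (m * l) m a
                 \<in> (\<Union>t\<in>T. cyclotomic_class e \<gamma> t)}
           \<union> {(a, 0) |a. a \<in> A - {0}}"
  proof -
    have "(\<Union>i<e. cyclotomic_class e \<alpha> i \<times> (\<Union>t\<in>T. cyclotomic_class e \<beta> ((i + t) mod e)))
      = {(a, b). a \<in> A \<and> b \<in> B \<and> a * b \<noteq> 0 \<and> Nm Q (l + 1) b / Nm Q l a \<in> (\<Union>t\<in>T. cyclotomic_class e \<gamma> t)}"
      using \<open>field_norm q (m * l) m \<alpha> = \<gamma>\<close> \<open>field_norm q (m * (l + 1)) m \<beta> = \<gamma>\<close> unfolding fn
      by (rule cyclotomic_product_eq_norm_quotient[OF sub(2) fin(2) e0 eK \<open>primitive_element K \<gamma>\<close>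
            \<open>primitive_element A \<alpha>\<close> \<open>primitive_element B \<beta>\<close>])
    moreover have "(A - {0}) \<times> {0::'f} = {(a, 0) |a. a \<in> A - {0}}" by auto
    ultimately show ?thesis unfolding D fn by (simp only:)
  qed
  then have D2: "D = {(a, b). a \<in> A \<and> b \<in> B \<and> a * b \<noteq> 0 \<and>
               field_norm q (m * (l + 1)) m b / field_norm q (m * l) m a \<in> R - {0}}
           \<union> {(a, 0) |a. a \<in> A - {0}}"
    unfolding union .
  \<comment> \<open>The two parts of D are the cases of nonzero and zero b: a nonzero b has a
    nonzero norm quotient, and b = 0 has quotient 0, which lies in R.\<close>
  have D_eq: "D = quotient_set"
  proof -
    have N0: "Nm Q (Suc l) b = 0 \<longleftrightarrow> b = 0" "Nm Q l a = 0 \<longleftrightarrow> a = 0" for a b :: 'f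
      using \<open>l \<ge> 1\<close> by (simp_all add: Nm_eq_0_iff)
    have "0 \<in> B" using subfield_0[OF sub(4)] .
    have "(a, b) \<in> D \<longleftrightarrow> a \<in> A \<and> b \<in> B \<and> a \<noteq> 0 \<and> Nm Q (Suc l) b / Nm Q l a \<in> R" for a b
    proof (cases "b = 0")
      case True
      have "(a, b) \<in> D \<longleftrightarrow> a \<in> A \<and> a \<noteq> 0" unfolding D2 using True by simp
      moreover have "Nm Q (Suc l) b = 0" using True N0(1)[of b] by blast
      ultimately show ?thesis using True \<open>0 \<in> B\<close> R(1) by (simp only: div_0) blast
    next
      case False
      have "(a, b) \<in> D \<longleftrightarrow> a \<in> A \<and> b \<in> B \<and> a \<noteq> 0 \<and> Nm Q (l + 1) b / Nm Q l a \<in> R - {0}"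
        unfolding D2 fn using False by simp
      moreover have "Nm Q (Suc l) b / Nm Q l a \<noteq> 0" if "a \<noteq> 0" using False that N0(1)[of b] N0(2)[of a] by simp
      ultimately show ?thesis by auto
    qed
    then have "p \<in> D \<longleftrightarrow> p \<in> quotient_set" for p
      unfolding quotient_set_def A_eq[symmetric] B_eq[symmetric] by (cases p) simp
    then show ?thesis by blast
  qed

  have G_carrier: "carrier G = A \<times> B" and G_one: "\<one>\<^bsub>G\<^esub> = (0, 0)" by (simp_all add: G)
  have card_G: "card (carrier G) = Q ^ (2 * l + 1)"
  proof -
    have "l + Suc l = 2 * l + 1" by simp
    then show ?thesis by (simp only: G_carrier card_cartesian_product cA cB power_add[symmetric])
  qed
  have grA: "group (additive_group A)" and grB: "group (additive_group B)"
    using cg[OF sub(3)] cg[OF sub(4)] comm_group.axioms(2) by blast+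
  have "group G" unfolding G using grA grB by (rule DirProd_group)
  then have G_comm: "comm_group G"
    by (rule group.group_comm_groupI) (auto simp: G add.commute)
  interpret G: comm_group G by (rule G_comm)
  have G_inv: "inv\<^bsub>G\<^esub> h = (- fst h, - snd h)" if "h \<in> A \<times> B" for h
    using that inv_DirProd[OF grA grB, of "fst h" "snd h"] inv_additive_group[OF cg[OF sub(3)], of "fst h"]
      inv_additive_group[OF cg[OF sub(4)], of "snd h"] subfield_uminus[OF sub(3)] subfield_uminus[OF sub(4)]
    by (auto simp: G)
  have G_diff: "g \<otimes>\<^bsub>G\<^esub> inv\<^bsub>G\<^esub> h = (fst g - fst h, snd g - snd h)" if "h \<in> A \<times> B" for g h
    using G_inv[OF that] by (simp add: G mult_DirProd')
  have iso: "G \<cong> product_group {..<s * m * (2 * l + 1)} (\<lambda>_. integer_mod_group p)"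
  proof (rule G.elementary_abelian_iso)
    show "finite (carrier G)" using fin by (simp add: G_carrier)
    show "card (carrier G) = p ^ (s * m * (2 * l + 1))"
      unfolding card_G QP by (simp only: power_mult)
    have "x [^]\<^bsub>G\<^esub> (n::nat) = (of_nat n * fst x, of_nat n * snd x)" for x n
      by (induction n) (auto simp: G mult_DirProd' algebra_simps)
    then show "x [^]\<^bsub>G\<^esub> p = \<one>\<^bsub>G\<^esub>" for x by (simp add: p0 G_one)
  qed fact

  have D_sub: "D \<subseteq> A \<times> B" unfolding D_eq A_eq B_eq by (rule quotient_set_sub)
  have D_fst: "fst x \<noteq> 0" if "x \<in> D" for x using that by (auto simp: D_eq quotient_set_def)
  have A_sub_D: "(a, 0) \<in> D" if "a \<in> A" "a \<noteq> 0" for a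
    using that unfolding D2 by auto
  have count: "card {(g, h). g \<in> D \<and> h \<in> D \<and> g \<noteq> h \<and> g \<otimes>\<^bsub>G\<^esub> inv\<^bsub>G\<^esub> h = x} = diff_count (fst x) (snd x)"
    if "x \<noteq> (0, 0)" for x
  proof -
    have "{(g, h). g \<in> D \<and> h \<in> D \<and> g \<noteq> h \<and> g \<otimes>\<^bsub>G\<^esub> inv\<^bsub>G\<^esub> h = x}
      = {(g, h). g \<in> quotient_set \<and> h \<in> quotient_set \<and> fst g - fst h = fst x \<and> snd g - snd h = snd x}"
      using that D_sub unfolding D_eq[symmetric] by (auto simp: G_diff subset_iff prod_eq_iff)
    then show ?thesis by (simp add: diff_count_def)
  qed
  have one_D: "(1, 0) \<in> D" using A_sub_D subfield_1[OF sub(3)] by simp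
  \<comment> \<open>The counts will turn out constant on D and on the nonzero elements outside D, so
    they are read off at one point of each kind: (1, 0) lies in D and (0, 1) does not.\<close>
  define k lam mu where "k = card D" and "lam = diff_count 1 0" and "mu = diff_count 0 1"
  have lam_real: "real (diff_count x y) = real k + \<theta>\<^sub>1 * \<theta>\<^sub>2 + \<theta>\<^sub>1 + \<theta>\<^sub>2" if "(x, y) \<in> D" for x y
    using diff_count_eq[of x y] that D_sub D_fst[OF that] unfolding k_def D_eq A_eq B_eq by auto
  have mu_real: "real (diff_count x y) = real k + \<theta>\<^sub>1 * \<theta>\<^sub>2" if "(x, y) \<in> A \<times> B" "(x, y) \<notin> D" "(x, y) \<noteq> (0, 0)" for x y
    using diff_count_eq[of x y] that unfolding k_def D_eq A_eq B_eq by auto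
  have zero_one: "(0, 1) \<in> A \<times> B" "(0, 1) \<notin> D"
    using subfield_0[OF sub(3)] subfield_1[OF sub(4)] D_fst by force+
  have pds: "partial_difference_set G D (q ^ (m * (2 * l + 1))) k lam mu"
    unfolding partial_difference_set_def
  proof (intro conjI ballI)
    show "card (carrier G) = q ^ (m * (2 * l + 1))"
      unfolding card_G Q_def by (simp only: power_mult)
    show "\<one>\<^bsub>G\<^esub> \<notin> D" using D_fst by (force simp: G_one)
    fix x assume x: "x \<in> D"
    then have "real (diff_count (fst x) (snd x)) = real lam"
      unfolding lam_def using lam_real[of "fst x" "snd x"] lam_real[OF one_D] by simp
    moreover have "x \<noteq> (0, 0)" using D_fst[OF x] by auto
    ultimately show "card {(g, h). g \<in> D \<and> h \<in> D \<and> g \<noteq> h \<and> g \<otimes>\<^bsub>G\<^esub> inv\<^bsub>G\<^esub> h = x} = lam"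
      using count by simp
  next
    fix x assume x: "x \<in> carrier G - D - {\<one>\<^bsub>G\<^esub>}"
    then have "real (diff_count (fst x) (snd x)) = real mu"
      unfolding mu_def using mu_real[of "fst x" "snd x"] mu_real[OF zero_one] by (simp add: G_carrier G_one)
    moreover have "x \<noteq> (0, 0)" using x by (simp add: G_one)
    ultimately show "card {(g, h). g \<in> D \<and> h \<in> D \<and> g \<noteq> h \<and> g \<otimes>\<^bsub>G\<^esub> inv\<^bsub>G\<^esub> h = x} = mu"
      using count by simp
  qed (use fin D_sub G_comm in \<open>auto simp: k_def G_carrier\<close>)
  have srg: "strongly_regular_graph (Cay G D) (q ^ (m * (2 * l + 1))) k lam mu"
  proof (rule G.strongly_regular_Cay[OF pds])
    fix x assume "x \<in> D"
    then show "inv\<^bsub>G\<^esub> x \<in> D" using D_sub quotient_set_uminus[of "fst x" "snd x"] by (auto simp: G_inv D_eq)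
  qed

  have fib: "real (fibre_size n) = (real Q ^ n - 1) / (real Q - 1)" for n
  proof -
    have "real ((Q - 1) * fibre_size n) = real (Q ^ n - 1)" by (simp only: fibre_size_mult)
    then have "(real Q - 1) * real (fibre_size n) = real Q ^ n - 1" using Q2 by (simp add: of_nat_diff)
    then show ?thesis using Q2 by (simp add: field_simps)
  qed
  have \<rho>: "real \<rho> = real q ^ r - 1"
  proof -
    have "real (Suc \<rho>) = real (q ^ r)" using card_R R(4) \<open>card Fq = q\<close> by simp
    then show ?thesis by simp
  qed
  have pow: "real q ^ m = real Q" "real q ^ (m * l) = real Q ^ l" "real q ^ (m * (l + 1)) = real Q ^ Suc l"
    by (simp_all only: Q_def of_nat_power power_mult[symmetric] Suc_eq_plus1)
  have k: "real k = (real Q ^ l - 1) * (1 + real \<rho> * real (fibre_size (Suc l)))"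
    unfolding k_def D_eq using card_quotient_set by simp
  \<comment> \<open>Folding the quotients into \<open>fibre_size\<close> removes all divisions; here
    and for the next two parameters a polynomial identity in \<open>Q ^ l\<close>,
    \<open>\<rho>\<close> and the fibre sizes remains.\<close>
  have k_eq: "real k = (real q ^ r - 1) * (real q ^ (m * l) - 1) * (real q ^ (m * (l + 1)) - 1)
                     / (real q ^ m - 1) + real q ^ (m * l) - 1"
    unfolding pow \<rho>[symmetric] times_divide_eq_right[symmetric] fib[symmetric] k by (simp only: algebra_simps)
  have lam_eq: "real lam = (real q ^ r - 1) * (real q ^ (m * (l + 1)) - 1) / (real q ^ m - 1)
                       * ((real q ^ r - 1) * (real q ^ (m * l) - 1) / (real q ^ m - 1) - 1)
                     + real q ^ (m * l) - 2"
    unfolding pow \<rho>[symmetric] times_divide_eq_right[symmetric] fib[symmetric] lam_def lam_real[OF one_D] k \<theta>\<^sub>1_def \<theta>\<^sub>2_def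
    by (simp add: algebra_simps)
  have mu_eq: "real mu = (real q ^ r - 1) * (real q ^ (m * l) - 1) / (real q ^ m - 1)
                      * ((real q ^ r - 1) * (real q ^ (m * (l + 1)) - 1) / (real q ^ m - 1) + 1)"
    unfolding pow \<rho>[symmetric] times_divide_eq_right[symmetric] fib[symmetric] mu_def
      mu_real[OF zero_one, simplified] k \<theta>\<^sub>1_def \<theta>\<^sub>2_def
    by (simp add: algebra_simps)

  have clique: "maximum_clique (Cay G D) (A \<times> {0})"
    unfolding maximum_clique_def
  proof (intro conjI allI impI)
    have "(x, y) \<in> parcs (Cay G D)" if "x \<in> A \<times> {0}" "y \<in> A \<times> {0}" "x \<noteq> y" for x y
    proof -
      have "fst x - fst y \<in> A" using that subfield_add[OF sub(3), of "fst x" "- fst y"] subfield_uminus[OF sub(3)] by auto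
      then have "(fst x - fst y, 0) \<in> D" using that by (intro A_sub_D) auto
      then show ?thesis using that subfield_0[OF sub(4)] by (auto simp: G_carrier G_diff)
    qed
    then show "clique (Cay G D) (A \<times> {0})"
      using subfield_0[OF sub(4)] by (auto simp: clique_def G_carrier)
    fix S assume "clique (Cay G D) S"
    then have S: "S \<subseteq> A \<times> B" "\<And>x y. x \<in> S \<Longrightarrow> y \<in> S \<Longrightarrow> x \<noteq> y \<Longrightarrow> x \<otimes>\<^bsub>G\<^esub> inv\<^bsub>G\<^esub> y \<in> D"
      by (auto simp: clique_def G_carrier)
    \<comment> \<open>Elements of D have nonzero first component, so distinct vertices of a clique
      differ in the first component and the projection to A bounds the size.\<close>
    have "inj_on fst S"
    proof (rule inj_onI, rule ccontr)
      fix x y assume xy: "x \<in> S" "y \<in> S" "fst x = fst y" "x \<noteq> y"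
      then have "y \<in> A \<times> B" using S(1) by blast
      then show False using D_fst[OF S(2)[OF xy(1,2,4)]] xy(3) by (simp add: G_diff)
    qed
    then have "card S \<le> card A"
      using S(1) fin(3) by (intro card_inj_on_le[of fst]) auto
    then show "card S \<le> card (A \<times> {0::'f})" by (simp add: card_cartesian_product)
  qed
  have card: "card (A \<times> {0 :: 'f}) = q ^ (m * l)"
    using \<open>card A = q ^ (m * l)\<close> by (simp add: card_cartesian_product)
  show ?thesis
    using iso k_eq lam_eq mu_eq pds srg D1 D2 clique card by blast
qed

end
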